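(* Using the order $<_1$ on $\mathcal A$, \[ C_\lambda[X(t-1);q,t]=\sum_{\sigma}(-1)^{m(\sigma)}q^{\mathrm{maj}(\sigma)}t^{p(\sigma)+\mathrm{quinv}(\sigma)}x^{|\sigma|}, \] where the sum runs over all super fillings $\sigma$ of $\mathrm{dg}(\lambda)$ in which no attacking pair of cells $u,v$ has $|\sigma(u)|=|\sigma(v)|$. Moreover $C_\lambda[X(t-1);q,t]=\sum_{\mu\le\lambda}c_{\mu\lambda}(q,t)\,m_\mu(X)$ for some $c_{\mu\lambda}(q,t)\in\mathbb Q(q,t)$, where $\le$ is dominance order and $m_\mu$ are monomial symmetric functions.
   Context: Let $\lambda=(\lambda_1\ge\dots\ge\lambda_k>0)$ be a partition; $\mathrm{dg}(\lambda)=\{(r,i):1\le i\le k,1\le r\le\lambda_i\}$, $(r,i)$ being row $r$ from the bottom and column $i$ from the left (columns bottom-justified of heights $\lambda_i$); $\mathrm{leg}((r,i))=\lambda_i-r$. $C_\lambda(X;q,t)=\sum_\sigma q^{\mathrm{maj}(\sigma)}t^{\mathrm{quinv}(\sigma)}x^\sigma$ over fillings $\sigma:\mathrm{dg}(\lambda)\to\mathbb Z_{>0}$ (the special case of the super-filling statistics below with all entries positive); it is a symmetric function, and $f[X(t-1)]$ denotes the plethysm sending power sums $p_m(X)\mapsto(t^m-1)p_m(X)$. Super fillings: $\mathcal A=\{1,\bar1,2,\bar2,\dots\}$ consists of positive letters $i$ and negative letters $\bar i$, with $|i|=|\bar i|=i$. The total order $<_1$ on $\mathcal A\cup\{0\}$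 is $0<1<\bar1<2<\bar2<\cdots$ (and $<_2$ is $0<1<2<3<\cdots<\bar3<\bar2<\bar1$). For the chosen order, $I(a,b)=1$ if $a>b$ or $a=b$ is negative, and $I(a,b)=0$ if $a<b$ or $a=b$ is positive. A super filling is a map $\sigma:\mathrm{dg}(\lambda)\to\mathcal A$. A cell $u=(r,i)$ with $r>1$ is a descent if $I(\sigma(u),\sigma((r-1,i)))=1$, and $\mathrm{maj}(\sigma)=\sum_{\text{descents }u}(\mathrm{leg}(u)+1)$. A triple is either three cells $(r+1,i),(r,i),(r,j)$ with $i<j$, or (degenerate) two cells $(r,i),(r,j)$ with $i<j$ and $\lambda_i=r$; with $a=\sigma((r+1,i))$ ($a=0$ if degenerate), $b=\sigma((r,i))$, $c=\sigma((r,j))$, it is a quinv triple iff exactly one of the three conditions $I(a,b)=1$, $I(c,b)=0$, $I(a,c)=0$ holds; $\mathrm{quinv}(\sigma)$ is the number of quinv triples. $|\sigma|$ is the filling $u\mapsto|\sigma(u)|$, $x^{|\sigma|}=\prod_u x_{|\sigma(u)|}$, and $p(\sigma)$, $m(\sigma)$ are the numbers of cells with positive, resp. negative, entries. Two distinct cells $(r,i)$ and $(r',j)$ with $i<j$ form an attacking pair if $r=r'$ or $r=r'+1$. *)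

theory Defs
  imports Main "HOL-Library.Multiset"
begin

definition is_partition :: "nat list \<Rightarrow> bool" where
  "is_partition lam \<longleftrightarrow> sorted_wrt (\<ge>) lam \<and> (\<forall>x\<in>set lam. 0 < x)"

(* column i (1-indexed from the left) has height lam_i *)
definition col_ht :: "nat list \<Rightarrow> nat \<Rightarrow> nat" where
  "col_ht lam i = lam ! (i - 1)"

(* cells (r,i): row r from the bottom, column i from the left *)
definition dg :: "nat list \<Rightarrow> (nat \<times> nat) set" where
  "dg lam = {(r, i). 1 \<le> i \<and> i \<le> length lam \<and> 1 \<le> r \<and> r \<le> col_ht lam i}"

definition leg :: "nat list \<Rightarrow> nat \<times> nat \<Rightarrow> nat" where
  "leg lam u = col_ht lam (snd u) - fst u"

(* a letter (k, False) is the positive letter k, (k, True) is the negative letter bar k;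
   (0, False) plays the role of the extra symbol 0 *)
type_synonym letter = "nat \<times> bool"

definition zero_letter :: letter where "zero_letter = (0, False)"

(* rank in the total order 0 < 1 < bar1 < 2 < bar2 < ... *)
definition rank1 :: "letter \<Rightarrow> nat" where
  "rank1 a = 2 * fst a + (if snd a then 1 else 0)"

definition Iv :: "letter \<Rightarrow> letter \<Rightarrow> bool" where
  "Iv a b \<longleftrightarrow> rank1 a > rank1 b \<or> (a = b \<and> snd a)"

(* super fillings of dg(lam), normalised to zero_letter outside the diagram *)
definition superfillings :: "nat list \<Rightarrow> (nat \<times> nat \<Rightarrow> letter) set" where
  "superfillings lam = {\<sigma>. (\<forall>u\<in>dg lam. 1 \<le> fst (\<sigma> u)) \<and> (\<forall>u. u \<notin> dg lam \<longrightarrow> \<sigma> u = zero_letter)}"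

definition posfillings :: "nat list \<Rightarrow> (nat \<times> nat \<Rightarrow> letter) set" where
  "posfillings lam = {\<sigma> \<in> superfillings lam. \<forall>u\<in>dg lam. \<not> snd (\<sigma> u)}"

definition is_descent :: "nat list \<Rightarrow> (nat \<times> nat \<Rightarrow> letter) \<Rightarrow> nat \<times> nat \<Rightarrow> bool" where
  "is_descent lam \<sigma> u \<longleftrightarrow> u \<in> dg lam \<and> fst u > 1 \<and> Iv (\<sigma> u) (\<sigma> (fst u - 1, snd u))"

definition maj :: "nat list \<Rightarrow> (nat \<times> nat \<Rightarrow> letter) \<Rightarrow> nat" where
  "maj lam \<sigma> = (\<Sum>u \<in> {u. is_descent lam \<sigma> u}. leg lam u + 1)"

definition exactly_one :: "bool \<Rightarrow> bool \<Rightarrow> bool \<Rightarrow> bool" where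
  "exactly_one x y z \<longleftrightarrow> (x \<and> \<not> y \<and> \<not> z) \<or> (\<not> x \<and> y \<and> \<not> z) \<or> (\<not> x \<and> \<not> y \<and> z)"

definition is_quinv_triple :: "nat list \<Rightarrow> (nat \<times> nat \<Rightarrow> letter) \<Rightarrow> nat \<times> nat \<times> nat \<Rightarrow> bool" where
  "is_quinv_triple lam \<sigma> x = (case x of (r, i, j) \<Rightarrow>
     (r, i) \<in> dg lam \<and> (r, j) \<in> dg lam \<and> i < j \<and>
     ((r + 1, i) \<in> dg lam \<or> col_ht lam i = r) \<and>
     (let a = (if (r + 1, i) \<in> dg lam then \<sigma> (r + 1, i) else zero_letter);
          b = \<sigma> (r, i); c = \<sigma> (r, j)
      in exactly_one (Iv a b) (\<not> Iv c b) (\<not> Iv a c)))"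

definition quinv :: "nat list \<Rightarrow> (nat \<times> nat \<Rightarrow> letter) \<Rightarrow> nat" where
  "quinv lam \<sigma> = card {x. is_quinv_triple lam \<sigma> x}"

definition npos :: "nat list \<Rightarrow> (nat \<times> nat \<Rightarrow> letter) \<Rightarrow> nat" where
  "npos lam \<sigma> = card {u \<in> dg lam. \<not> snd (\<sigma> u)}"

definition nneg :: "nat list \<Rightarrow> (nat \<times> nat \<Rightarrow> letter) \<Rightarrow> nat" where
  "nneg lam \<sigma> = card {u \<in> dg lam. snd (\<sigma> u)}"

(* exponent vector of x^{|sigma|}: alpha k = number of cells with |sigma(u)| = k *)
definition content :: "nat list \<Rightarrow> (nat \<times> nat \<Rightarrow> letter) \<Rightarrow> nat \<Rightarrow> nat" where
  "content lam \<sigma> = (\<lambda>k. card {u \<in> dg lam. fst (\<sigma> u) = k})"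

definition attacking :: "nat \<times> nat \<Rightarrow> nat \<times> nat \<Rightarrow> bool" where
  "attacking u v \<longleftrightarrow> u \<noteq> v \<and> snd u < snd v \<and> (fst u = fst v \<or> fst u = fst v + 1)"

definition nonattacking :: "nat list \<Rightarrow> (nat \<times> nat \<Rightarrow> letter) \<Rightarrow> bool" where
  "nonattacking lam \<sigma> \<longleftrightarrow>
     (\<forall>u\<in>dg lam. \<forall>v\<in>dg lam. attacking u v \<longrightarrow> fst (\<sigma> u) \<noteq> fst (\<sigma> v))"

section \<open>Formal series in x_1, x_2, ... as coefficient functions on exponent vectors\<close>

definition C_ser :: "nat list \<Rightarrow> 'a::comm_ring_1 \<Rightarrow> 'a \<Rightarrow> (nat \<Rightarrow> nat) \<Rightarrow> 'a" where
  "C_ser lam q t \<alpha> =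
     (\<Sum>\<sigma> \<in> {\<sigma> \<in> posfillings lam. content lam \<sigma> = \<alpha>}. q ^ maj lam \<sigma> * t ^ quinv lam \<sigma>)"

definition S_ser :: "nat list \<Rightarrow> 'a::comm_ring_1 \<Rightarrow> 'a \<Rightarrow> (nat \<Rightarrow> nat) \<Rightarrow> 'a" where
  "S_ser lam q t \<alpha> =
     (\<Sum>\<sigma> \<in> {\<sigma> \<in> superfillings lam. nonattacking lam \<sigma> \<and> content lam \<sigma> = \<alpha>}.
        (-1) ^ nneg lam \<sigma> * q ^ maj lam \<sigma> * t ^ (npos lam \<sigma> + quinv lam \<sigma>))"

(* coefficient of x^alpha in the power sum p_mu = prod_i p_{mu_i}, p_m = sum_{k>=1} x_k^m *)
definition pcoeff :: "nat list \<Rightarrow> (nat \<Rightarrow> nat) \<Rightarrow> nat" where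
  "pcoeff mu \<alpha> = card {\<phi> :: nat \<Rightarrow> nat.
      (\<forall>i < length mu. 1 \<le> \<phi> i) \<and> (\<forall>i. length mu \<le> i \<longrightarrow> \<phi> i = 0) \<and>
      (\<forall>k. \<alpha> k = (\<Sum>i \<in> {i. i < length mu \<and> \<phi> i = k}. mu ! i))}"

(* coefficient of x^alpha in the monomial symmetric function m_mu *)
definition mcoeff :: "nat list \<Rightarrow> (nat \<Rightarrow> nat) \<Rightarrow> nat" where
  "mcoeff mu \<alpha> = (if \<alpha> 0 = 0 \<and> finite {k. \<alpha> k \<noteq> 0} \<and>
                       image_mset \<alpha> (mset_set {k. \<alpha> k \<noteq> 0}) = mset mu then 1 else 0)"

(* g = f[X(t-1)]: f = sum_mu a_mu p_mu (finite), g = sum_mu a_mu prod_i (t^{mu_i} - 1) p_mu *)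
definition pleth_Xt1 :: "'a::field \<Rightarrow> ((nat \<Rightarrow> nat) \<Rightarrow> 'a) \<Rightarrow> ((nat \<Rightarrow> nat) \<Rightarrow> 'a) \<Rightarrow> bool" where
  "pleth_Xt1 t f g \<longleftrightarrow> (\<exists>a :: nat list \<Rightarrow> 'a.
     finite {mu. a mu \<noteq> 0} \<and> (\<forall>mu. a mu \<noteq> 0 \<longrightarrow> is_partition mu) \<and>
     (\<forall>\<alpha>. f \<alpha> = (\<Sum>mu \<in> {mu. a mu \<noteq> 0}. a mu * of_nat (pcoeff mu \<alpha>))) \<and>
     (\<forall>\<alpha>. g \<alpha> = (\<Sum>mu \<in> {mu. a mu \<noteq> 0}.
                   a mu * (\<Prod>i < length mu. t ^ (mu ! i) - 1) * of_nat (pcoeff mu \<alpha>))))"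

definition dominated :: "nat list \<Rightarrow> nat list \<Rightarrow> bool" where
  "dominated mu lam \<longleftrightarrow> sum_list mu = sum_list lam \<and>
     (\<forall>i. sum_list (take i mu) \<le> sum_list (take i lam))"

end

theory Submission
  imports "HOL-Combinatorics.Permutations" "HOL-Library.Product_Lexorder"
    "HOL-Computational_Algebra.Polynomial" Defs
begin

text \<open>
  Symmetry. For \<open>t \<noteq> 0\<close> the weight \<open>q^maj t^quinv\<close> is a product over pairs of cells
  \<open>u\<close>, \<open>v\<close> with \<open>I(u, v) = 1\<close>: a quinv triple is counted by \<open>I(c, b) + I(a, c) - I(a, b)\<close>, so an
  attacking pair contributes \<open>t\<close> and a vertical pair contributes a monomial in \<open>q\<close> and \<open>1/t\<close>. In the
  reading order a cell attacks precisely the cells between itself and the cell below it. Fixing all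
  letters except \<open>k\<close> and \<open>k + 1\<close> leaves a two-letter sum over such an interval graph, which is seen
  to be symmetric by deleting one edge at a time. The case \<open>t = 0\<close> follows because both sides are
  polynomials in \<open>t\<close>.

  Superization. Toggling the sign of the last cell with absolute value \<open>k\<close> changes no \<open>I(u, v)\<close> with
  \<open>u\<close> before \<open>v\<close>, so signed sums over super fillings satisfy the cancellation law of
  \<open>f[X - Y]\<close>. Power sums in a signed alphabet satisfy the same law, and the law determines the
  signed sums from the purely positive ones. Hence every power sum expansion of \<open>C\<close>
  yields the signed sum over all super fillings as \<open>C[X(t - 1)]\<close>.

  Cancellation. Toggling the last cell that attacks a later cell with the same absolute value
  changes quinv by exactly one and leaves maj alone, which removes all fillings that are not
  non-attacking. In a non-attacking filling every row has distinct absolute values; this gives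
  the dominance bound.
\<close>

section \<open>Two-letter symmetry\<close>

definition cut_weight :: "('b \<Rightarrow> 'b \<Rightarrow> 'a::comm_monoid_mult) \<Rightarrow> 'b set \<Rightarrow> 'b set \<Rightarrow> 'a" where
  "cut_weight w V S = (\<Prod>u\<in>S. \<Prod>v\<in>V - S. w u v)"

definition interval_weight :: "'a::one \<Rightarrow> 'b::linorder set \<Rightarrow> ('b \<Rightarrow> 'b \<Rightarrow> 'a) \<Rightarrow> bool" where
  "interval_weight t V w \<longleftrightarrow>
     (\<forall>u\<in>V. \<forall>v\<in>V. w u v \<noteq> 1 \<longrightarrow> v < u \<and> (\<forall>x\<in>V. v < x \<and> x < u \<longrightarrow> w u x = t \<and> w x v = t))"

definition nontrivial_pairs :: "('b \<Rightarrow> 'b \<Rightarrow> 'a::one) \<Rightarrow> 'b set \<Rightarrow> ('b \<times> 'b) set" where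
  "nontrivial_pairs w V = {(u, v) \<in> V \<times> V. w u v \<noteq> 1}"

definition outermost_pair :: "('b::linorder \<Rightarrow> 'b \<Rightarrow> 'a::one) \<Rightarrow> 'b set \<Rightarrow> 'b \<Rightarrow> 'b \<Rightarrow> bool" where
  "outermost_pair w V i j \<longleftrightarrow> i \<in> V \<and> j \<in> V \<and> w i j \<noteq> 1 \<and>
     (\<forall>u\<in>V. i < u \<longrightarrow> w u j = 1) \<and> (\<forall>v\<in>V. v < j \<longrightarrow> w i v = 1)"

definition delete_pair :: "('b \<Rightarrow> 'b \<Rightarrow> 'a::one) \<Rightarrow> 'b \<Rightarrow> 'b \<Rightarrow> 'b \<Rightarrow> 'b \<Rightarrow> 'a" where
  "delete_pair w i j u v = (if u = i \<and> v = j then 1 else w u v)"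

lemma finite_nontrivial_pairs: "finite V \<Longrightarrow> finite (nontrivial_pairs w V)"
  by (rule finite_subset[of _ "V \<times> V"]) (auto simp: nontrivial_pairs_def)

lemma ex_outermost_pair:
  assumes "finite V" "nontrivial_pairs w V \<noteq> {}"
  obtains i j where "outermost_pair w V i j"
proof -
  define U where "U = {u\<in>V. \<exists>v\<in>V. w u v \<noteq> 1}"
  define i where "i = Max U"
  define N where "N = {v\<in>V. w i v \<noteq> 1}"
  have U: "finite U" "U \<noteq> {}" using assms by (auto simp: U_def nontrivial_pairs_def)
  then have "i \<in> U" unfolding i_def by (rule Max_in)
  then have N: "finite N" "N \<noteq> {}" using assms(1) by (auto simp: U_def N_def)
  then have "Min N \<in> N" by (rule Min_in)
  moreover have "w u (Min N) = 1" if "u \<in> V" "i < u" for u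
  proof -
    have "Min N \<in> V" using \<open>Min N \<in> N\<close> by (simp add: N_def)
    moreover have "u \<notin> U" using Max_ge[OF U(1), of u] that(2) by (auto simp: i_def)
    ultimately show ?thesis using that(1) by (auto simp: U_def)
  qed
  moreover have "w i v = 1" if "v \<in> V" "v < Min N" for v
  proof -
    have "v \<notin> N" using Min_le[OF N(1), of v] that(2) by auto
    then show ?thesis using that(1) by (simp add: N_def)
  qed
  ultimately have "outermost_pair w V i (Min N)"
    using \<open>i \<in> U\<close> by (auto simp: outermost_pair_def U_def N_def)
  then show ?thesis by (rule that)
qed

lemma interval_weight_subset: "interval_weight t V w \<Longrightarrow> V' \<subseteq> V \<Longrightarrow> interval_weight t V' w"
  unfolding interval_weight_def by blast

lemma interval_weight_delete_pair:
  assumes "interval_weight t V w" "outermost_pair w V i j"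
  shows "interval_weight t V (delete_pair w i j)"
  unfolding interval_weight_def
proof (intro ballI impI)
  fix u v assume uv: "u \<in> V" "v \<in> V" "delete_pair w i j u v \<noteq> 1"
  then have w: "w u v \<noteq> 1" by (auto simp: delete_pair_def split: if_splits)
  then have "v < u" "\<forall>x\<in>V. v < x \<and> x < u \<longrightarrow> w u x = t \<and> w x v = t"
    using assms(1) uv unfolding interval_weight_def by blast+
  moreover have "\<not> (u = i \<and> v < j)" "\<not> (v = j \<and> i < u)"
    using assms(2) uv w by (auto simp: outermost_pair_def)
  ultimately show "v < u \<and> (\<forall>x\<in>V. v < x \<and> x < u \<longrightarrow>
      delete_pair w i j u x = t \<and> delete_pair w i j x v = t)"
    by (auto simp: delete_pair_def)
qed

lemma outermost_pair_less: "interval_weight t V w \<Longrightarrow> outermost_pair w V i j \<Longrightarrow> j < i"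
  unfolding interval_weight_def outermost_pair_def by blast

lemma interval_weight_eq_1: "interval_weight t V w \<Longrightarrow> u \<in> V \<Longrightarrow> v \<in> V \<Longrightarrow> u \<le> v \<Longrightarrow> w u v = 1"
  unfolding interval_weight_def by (meson leD)

lemma outermost_pair_weights:
  assumes "interval_weight t V w" "outermost_pair w V i j" "x \<in> V - {i, j}"
  shows "w i x = (if j < x \<and> x < i then t else 1)" "w x j = (if j < x \<and> x < i then t else 1)"
proof -
  have x: "x \<in> V" "x \<noteq> i" "x \<noteq> j" and ij: "i \<in> V" "j \<in> V" "w i j \<noteq> 1"
    using assms(2,3) by (auto simp: outermost_pair_def)
  have "w i x = t \<and> w x j = t" if "j < x \<and> x < i"
    using assms(1) x ij that unfolding interval_weight_def by blast
  moreover have "w i x = 1 \<and> w x j = 1" if outside: "\<not> (j < x \<and> x < i)"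
  proof -
    consider "x < j" | "i < x" using outside x(2,3) by (meson neqE)
    then show ?thesis
      using assms(2) x(1) ij interval_weight_eq_1[OF assms(1)]
      by cases (auto simp: outermost_pair_def)
  qed
  ultimately show "w i x = (if j < x \<and> x < i then t else 1)"
    "w x j = (if j < x \<and> x < i then t else 1)"
    by auto
qed

lemma cut_weight_cong:
  assumes "\<And>u v. u \<in> S \<Longrightarrow> v \<in> V - S \<Longrightarrow> w u v = w' u v"
  shows "cut_weight w V S = cut_weight w' V S"
  unfolding cut_weight_def using assms by (intro prod.cong refl)

lemma cut_weight_insert:
  assumes "finite V" "i \<in> V" "j \<in> V" "i \<noteq> j" "R \<subseteq> V - {i, j}"
  shows "cut_weight w V (insert i R) =
    w i j * ((\<Prod>v\<in>V - {i, j} - R. w i v) * (\<Prod>u\<in>R. w u j)) * cut_weight w (V - {i, j}) R"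
proof -
  define U where "U = V - {i, j} - R"
  have "V - insert i R = insert j U" "j \<notin> U" "i \<notin> R" using assms by (auto simp: U_def)
  moreover have "finite R" "finite U" using assms by (auto simp: U_def intro: finite_subset)
  ultimately show ?thesis
    unfolding cut_weight_def U_def[symmetric] by (simp add: prod.distrib mult_ac)
qed

text \<open>Once \<open>i \<in> S\<close> and \<open>j \<notin> S\<close>, every cell between them contributes the factor \<open>t\<close> together with
  \<open>i\<close> or with \<open>j\<close>, whether or not it lies in \<open>S\<close>.\<close>

lemma outermost_pair_cross_weight:
  assumes "finite V" "interval_weight t V w" "outermost_pair w V i j" "R \<subseteq> V - {i, j}"
  shows "(\<Prod>v\<in>V - {i, j} - R. w i v) * (\<Prod>u\<in>R. w u j) = t ^ card {x\<in>V. j < x \<and> x < i}"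
proof -
  define U where "U = V - {i, j}"
  define between where "between x = (if j < x \<and> x < i then t else 1)" for x
  have U: "finite U" "R \<subseteq> U" using assms(1,4) by (auto simp: U_def)
  have weights: "w i x = between x" "w x j = between x" if "x \<in> U" for x
    using outermost_pair_weights[OF assms(2,3)] that by (simp_all add: between_def U_def)
  have "(\<Prod>v\<in>U - R. w i v) * (\<Prod>u\<in>R. w u j) = (\<Prod>v\<in>U - R. between v) * (\<Prod>u\<in>R. between u)"
    using U(2) by (intro arg_cong2[where f = "(*)"] prod.cong refl weights) auto
  also have "\<dots> = (\<Prod>x\<in>U. between x)" by (rule prod.subset_diff[OF U(2,1), symmetric])
  also have "\<dots> = (\<Prod>x\<in>{x\<in>U. j < x \<and> x < i}. t)"
    unfolding between_def by (rule prod.inter_filter[OF U(1), symmetric])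
  also have "{x\<in>U. j < x \<and> x < i} = {x\<in>V. j < x \<and> x < i}" by (auto simp: U_def)
  finally show ?thesis by (simp add: U_def)
qed

lemma cut_weight_insert_outermost:
  assumes "finite V" "interval_weight t V w" "outermost_pair w V i j" "R \<subseteq> V - {i, j}"
  shows "cut_weight w V (insert i R) =
      w i j * t ^ card {x\<in>V. j < x \<and> x < i} * cut_weight w (V - {i, j}) R"
    and "cut_weight (delete_pair w i j) V (insert i R) =
      t ^ card {x\<in>V. j < x \<and> x < i} * cut_weight w (V - {i, j}) R"
proof -
  define w' where "w' = delete_pair w i j"
  define U where "U = V - {i, j}"
  note cross = outermost_pair_cross_weight[OF assms]
  have ij: "i \<in> V" "j \<in> V" "i \<noteq> j"
    using assms(3) outermost_pair_less[OF assms(2,3)] by (auto simp: outermost_pair_def)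
  note insert = cut_weight_insert[OF assms(1) ij assms(4)]
  show "cut_weight w V (insert i R) =
      w i j * t ^ card {x\<in>V. j < x \<and> x < i} * cut_weight w (V - {i, j}) R"
    unfolding insert cross ..
  have "(\<Prod>v\<in>U - R. w' i v) = (\<Prod>v\<in>U - R. w i v)" "(\<Prod>u\<in>R. w' u j) = (\<Prod>u\<in>R. w u j)"
    "cut_weight w' U R = cut_weight w U R" "w' i j = 1"
    using assms(4) by (auto simp: w'_def delete_pair_def U_def intro!: prod.cong cut_weight_cong)
  then show "cut_weight (delete_pair w i j) V (insert i R) =
      t ^ card {x\<in>V. j < x \<and> x < i} * cut_weight w (V - {i, j}) R"
    unfolding w'_def[symmetric] insert cross[symmetric] U_def[symmetric] by simp
qed

lemma cut_weight_delete_pair: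
  fixes w :: "'b::linorder \<Rightarrow> 'b \<Rightarrow> 'a::comm_ring_1"
  assumes "finite V" "interval_weight t V w" "outermost_pair w V i j" "S \<subseteq> V"
  shows "cut_weight w V S = cut_weight (delete_pair w i j) V S +
    (if i \<in> S \<and> j \<notin> S
     then (w i j - 1) * t ^ card {x\<in>V. j < x \<and> x < i} * cut_weight w (V - {i, j}) (S - {i}) else 0)"
proof (cases "i \<in> S \<and> j \<notin> S")
  case True
  then have "S = insert i (S - {i})" "S - {i} \<subseteq> V - {i, j}" using assms(4) by auto
  then show ?thesis
    using True cut_weight_insert_outermost[OF assms(1-3), of "S - {i}"] by (simp add: algebra_simps)
next
  case False
  then show ?thesis using assms(3)
    by (auto intro!: cut_weight_cong simp: outermost_pair_def delete_pair_def)
qed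

lemma sum_cut_weight_delete_pair:
  fixes w :: "'b::linorder \<Rightarrow> 'b \<Rightarrow> 'a::comm_ring_1"
  assumes "finite V" "interval_weight t V w" "outermost_pair w V i j"
  shows "(\<Sum>S\<in>Pow V. f S * cut_weight w V S) =
    (\<Sum>S\<in>Pow V. f S * cut_weight (delete_pair w i j) V S) +
    (w i j - 1) * t ^ card {x\<in>V. j < x \<and> x < i} *
      (\<Sum>S\<in>Pow (V - {i, j}). f (insert i S) * cut_weight w (V - {i, j}) S)"
proof -
  define c where "c = (w i j - 1) * t ^ card {x\<in>V. j < x \<and> x < i}"
  define X where "X = cut_weight w (V - {i, j})"
  have ij: "i \<in> V" "j \<in> V" "i \<noteq> j"
    using assms(3) outermost_pair_less[OF assms(2,3)] by (auto simp: outermost_pair_def)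
  have "(\<Sum>S\<in>Pow V. f S * cut_weight w V S) =
      (\<Sum>S\<in>Pow V. f S * cut_weight (delete_pair w i j) V S) +
      (\<Sum>S\<in>Pow V. if i \<in> S \<and> j \<notin> S then f S * (c * X (S - {i})) else 0)"
    unfolding sum.distrib[symmetric] c_def X_def
    by (intro sum.cong refl) (auto simp: cut_weight_delete_pair[OF assms] distrib_left)
  also have "(\<Sum>S\<in>Pow V. if i \<in> S \<and> j \<notin> S then f S * (c * X (S - {i})) else 0) =
      (\<Sum>S\<in>{S\<in>Pow V. i \<in> S \<and> j \<notin> S}. f S * (c * X (S - {i})))"
    by (rule sum.inter_filter[symmetric]) (simp add: assms(1))
  also have "\<dots> = (\<Sum>S\<in>Pow (V - {i, j}). f (insert i S) * (c * X S))"
    using ij by (intro sum.reindex_bij_witness[of _ "insert i" "\<lambda>S. S - {i}"])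
      (auto simp: insert_absorb)
  finally show ?thesis by (simp add: sum_distrib_left c_def X_def mult_ac)
qed

lemma card_insert_within_pair:
  assumes "finite V" "i \<in> V" "j \<in> V" "i \<noteq> j" "S \<subseteq> V - {i, j}"
  shows "card (insert i S) = Suc (card S)" "card (V - insert i S) = Suc (card (V - {i, j} - S))"
proof -
  have "i \<notin> S" "finite S" using assms by (auto intro: finite_subset)
  then show "card (insert i S) = Suc (card S)" by simp
  have "V - insert i S = insert j (V - {i, j} - S)" "j \<notin> V - {i, j} - S" using assms by auto
  then show "card (V - insert i S) = Suc (card (V - {i, j} - S))" using assms(1) by simp
qed

lemma sum_Pow_complement: "(\<Sum>S\<in>Pow V. f (V - S)) = (\<Sum>S\<in>Pow V. f S)"
  by (rule sum.reindex_bij_witness[of _ "\<lambda>S. V - S" "\<lambda>S. V - S"]) (auto simp: double_diff)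

lemma card_nontrivial_pairs_less:
  assumes "finite V" "outermost_pair w V i j"
  shows "card (nontrivial_pairs (delete_pair w i j) V) < card (nontrivial_pairs w V)"
    and "card (nontrivial_pairs w (V - {i, j})) < card (nontrivial_pairs w V)"
proof -
  have "nontrivial_pairs (delete_pair w i j) V \<subset> nontrivial_pairs w V"
    "nontrivial_pairs w (V - {i, j}) \<subset> nontrivial_pairs w V"
    using assms(2)
    by (auto simp: nontrivial_pairs_def delete_pair_def outermost_pair_def split: if_splits)
  then show "card (nontrivial_pairs (delete_pair w i j) V) < card (nontrivial_pairs w V)"
    "card (nontrivial_pairs w (V - {i, j})) < card (nontrivial_pairs w V)"
    by (simp_all add: psubset_card_mono finite_nontrivial_pairs[OF assms(1)])
qed

theorem sum_cut_weight_complement: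
  fixes w :: "'b::linorder \<Rightarrow> 'b \<Rightarrow> 'a::comm_ring_1"
  assumes "finite V" "interval_weight t V w"
  shows "(\<Sum>S\<in>Pow V. g (card S) * cut_weight w V S) =
         (\<Sum>S\<in>Pow V. g (card (V - S)) * cut_weight w V S)"
  using assms
proof (induction "card (nontrivial_pairs w V)" arbitrary: V w g rule: less_induct)
  case less
  note fin = less.prems(1)
  show ?case
  proof (cases "nontrivial_pairs w V = {}")
    case True
    then have "cut_weight w V S = 1" if "S \<in> Pow V" for S
      using that unfolding cut_weight_def nontrivial_pairs_def by (intro prod.neutral ballI) blast
    then show ?thesis using sum_Pow_complement[of "\<lambda>S. g (card S)" V] by simp
  next
    case False
    then obtain i j where outermost: "outermost_pair w V i j" using ex_outermost_pair[OF fin]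
      by blast
    define w' where "w' = delete_pair w i j"
    define V' where "V' = V - {i, j}"
    have ij: "i \<in> V" "j \<in> V" "i \<noteq> j"
      using outermost outermost_pair_less[OF less.prems(2) outermost]
      by (auto simp: outermost_pair_def)
    note fewer = card_nontrivial_pairs_less[OF fin outermost, folded w'_def V'_def]
    have "interval_weight t V w'"
      unfolding w'_def by (rule interval_weight_delete_pair[OF less.prems(2) outermost])
    moreover have "interval_weight t V' w" "finite V'"
      using interval_weight_subset[OF less.prems(2)] fin by (auto simp: V'_def)
    moreover have "card (insert i S) = Suc (card S)" "card (V - insert i S) = Suc (card (V' - S))"
      if "S \<in> Pow V'" for S
      using card_insert_within_pair[OF fin ij, of S] that by (simp_all add: V'_def)
    ultimately show ?thesis
      unfolding sum_cut_weight_delete_pair[OF less.prems outermost]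
        w'_def[symmetric] V'_def[symmetric]
      using less.hyps[OF fewer(1) fin, of g] less.hyps[OF fewer(2), of "\<lambda>n. g (Suc n)"]
      by simp
  qed
qed

section \<open>Contents\<close>

text \<open>A monomial is represented by the multiset \<open>M\<close> of the indices of its variables, so its exponent
  vector is \<open>count M\<close>.\<close>

definition weighted_content :: "'b set \<Rightarrow> ('b \<Rightarrow> nat) \<Rightarrow> ('b \<Rightarrow> 'c) \<Rightarrow> 'c multiset" where
  "weighted_content J m f = (\<Sum>u\<in>J. replicate_mset (m u) (f u))"

definition multiplicities :: "'c multiset \<Rightarrow> nat multiset" where
  "multiplicities M = image_mset (count M) (mset_set (set_mset M))"

lemma count_weighted_content:
  assumes "finite J"
  shows "count (weighted_content J m f) c = (\<Sum>u | u \<in> J \<and> f u = c. m u)"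
  unfolding weighted_content_def count_sum
  using assms by (auto simp: sum.inter_filter intro!: sum.cong)

lemma weighted_content_cong:
  "(\<And>u. u \<in> J \<Longrightarrow> f u = g u) \<Longrightarrow> weighted_content J m f = weighted_content J m g"
  unfolding weighted_content_def by (rule sum.cong) simp_all

lemma image_mset_weighted_content:
  "image_mset g (weighted_content J m f) = weighted_content J m (g \<circ> f)"
  by (induction J rule: infinite_finite_induct) (simp_all add: weighted_content_def)

lemma filter_mset_weighted_content:
  assumes "finite J"
  shows "filter_mset P (weighted_content J m f) = weighted_content {u \<in> J. P (f u)} m f"
  using assms
  by (intro multiset_eqI) (auto simp: count_weighted_content intro!: sum.cong sum.neutral)

lemma size_weighted_content: "size (weighted_content J m f) = sum m J"
  by (induction J rule: infinite_finite_induct) (simp_all add: weighted_content_def)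

lemma set_mset_weighted_content:
  assumes "finite J" "\<And>u. u \<in> J \<Longrightarrow> 0 < m u"
  shows "set_mset (weighted_content J m f) = f ` J"
  unfolding weighted_content_def using assms
  by (auto simp: set_mset_sum set_mset_replicate_mset_subset)

lemma multiplicities_weighted_content:
  assumes "finite J" "\<And>u. u \<in> J \<Longrightarrow> 0 < m u" "inj_on f J"
  shows "multiplicities (weighted_content J m f) = image_mset m (mset_set J)"
proof -
  have "count (weighted_content J m f) (f u) = m u" if "u \<in> J" for u
  proof -
    have "{v. v \<in> J \<and> f v = f u} = {u}" using assms(3) that by (auto simp: inj_on_def)
    then show ?thesis by (simp add: count_weighted_content[OF assms(1)])
  qed
  then have "image_mset (count (weighted_content J m f) \<circ> f) (mset_set J) =
      image_mset m (mset_set J)"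
    using assms(1) by (intro image_mset_cong) simp
  moreover have "mset_set (f ` J) = image_mset f (mset_set J)"
    by (rule image_mset_mset_set[OF assms(3), symmetric])
  ultimately show ?thesis
    by (simp add: multiplicities_def set_mset_weighted_content[OF assms(1,2)] multiset.map_comp)
qed

lemma size_multiplicities: "size (multiplicities M) = card (set_mset M)"
  by (simp add: multiplicities_def)

lemma sum_mset_multiplicities: "sum_mset (multiplicities M) = size M"
  by (simp add: multiplicities_def size_multiset_overloaded_eq sum_unfold_sum_mset)

lemma image_mset_count_superset:
  assumes "finite A" "set_mset M \<subseteq> A"
  shows "image_mset (count M) (mset_set A) =
    multiplicities M + replicate_mset (card A - card (set_mset M)) 0"
proof -
  have "mset_set A = mset_set (set_mset M) + mset_set (A - set_mset M)"
    using assms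
    by (metis Diff_disjoint Un_Diff_cancel Un_absorb1 finite_Diff finite_set_mset mset_set_Union)
  moreover have "image_mset (count M) (mset_set (A - set_mset M)) =
      image_mset (\<lambda>_. 0) (mset_set (A - set_mset M))"
    using assms by (intro image_mset_cong) (auto simp: not_in_iff)
  ultimately show ?thesis
    using assms by (simp add: multiplicities_def image_mset_const_eq card_Diff_subset)
qed

section \<open>Symmetric series\<close>

definition symmetric_series :: "((nat \<Rightarrow> nat) \<Rightarrow> 'a) \<Rightarrow> bool" where
  "symmetric_series F \<longleftrightarrow> (\<forall>p A \<alpha>. p permutes A \<and> finite A \<and> 0 \<notin> A \<longrightarrow> F (\<alpha> \<circ> p) = F \<alpha>)"

definition homogeneous_series :: "nat \<Rightarrow> ((nat \<Rightarrow> nat) \<Rightarrow> 'a::zero) \<Rightarrow> bool" where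
  "homogeneous_series n F \<longleftrightarrow> (\<forall>\<alpha>. F \<alpha> \<noteq> 0 \<longrightarrow> (\<exists>M. \<alpha> = count M \<and> 0 \<notin># M \<and> size M = n))"

lemma invariant_transpose_if_adjacent:
  assumes "\<And>\<alpha> k. 1 \<le> k \<Longrightarrow> F (\<alpha> \<circ> transpose k (Suc k)) = F \<alpha>" and "1 \<le> a"
  shows "F (\<alpha> \<circ> transpose a (a + d)) = F \<alpha>"
proof (induction d arbitrary: \<alpha>)
  case 0
  then show ?case by simp
next
  case (Suc d)
  define b where "b = a + d"
  have swap: "F (\<alpha> \<circ> transpose b (Suc b)) = F \<alpha>" for \<alpha>
    using assms by (simp add: b_def)
  show ?case
  proof (cases "d = 0")
    case True
    then show ?thesis using swap[of \<alpha>] by (simp add: b_def comp_def)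
  next
    case False
    then have "transpose a (Suc b) = transpose b (Suc b) \<circ> transpose a b \<circ> transpose b (Suc b)"
      by (auto simp: fun_eq_iff transpose_def b_def)
    then have "\<alpha> \<circ> transpose a (a + Suc d) =
        ((\<alpha> \<circ> transpose b (Suc b)) \<circ> transpose a b) \<circ> transpose b (Suc b)"
      by (simp add: b_def o_assoc)
    then show ?thesis by (simp only: swap Suc.IH[folded b_def])
  qed
qed

lemma symmetric_series_if_adjacent:
  assumes adjacent: "\<And>\<alpha> k. 1 \<le> k \<Longrightarrow> F (\<alpha> \<circ> transpose k (Suc k)) = F \<alpha>"
  shows "symmetric_series F"
  unfolding symmetric_series_def
proof (intro allI impI, elim conjE)
  fix p A \<alpha> assume "p permutes A" "finite A" "(0::nat) \<notin> A"
  then show "F (\<alpha> \<circ> p) = F \<alpha>"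
  proof (induction arbitrary: \<alpha> rule: permutes_induct)
    case id
    then show ?case by simp
  next
    case (swap a b p)
    then have "1 \<le> min a b" by (metis One_nat_def Suc_leI gr0I min_def)
    then have "F (\<alpha> \<circ> transpose (min a b) (min a b + (max a b - min a b))) = F \<alpha>"
      by (intro invariant_transpose_if_adjacent[where F = F] adjacent)
    then have "F (\<alpha> \<circ> transpose a b) = F \<alpha>"
      by (cases "a \<le> b") (auto simp: min_def max_def transpose_commute)
    then show ?case by (simp only: o_assoc swap.IH[OF swap.prems])
  qed
qed

lemma symmetric_series_multiplicities:
  assumes "symmetric_series F" "0 \<notin># M" "0 \<notin># N" "multiplicities M = multiplicities N"
  shows "F (count M) = F (count N)"
proof -
  define A where "A = set_mset M \<union> set_mset N"
  have A: "finite A" "0 \<notin> A" using assms by (auto simp: A_def)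
  have "card (set_mset M) = card (set_mset N)" by (metis assms(4) size_multiplicities)
  then have "image_mset (count M) (mset_set A) = image_mset (count N) (mset_set A)"
    using A assms(4) by (simp add: image_mset_count_superset A_def)
  then obtain p where p: "p permutes A" "\<forall>x\<in>A. count M x = count N (p x)"
    by (rule image_mset_eq_implies_permutes[OF A(1)])
  have "count M x = count N (p x)" for x
    using p permutes_not_in[OF p(1), of x] by (cases "x \<in> A") (auto simp: A_def not_in_iff)
  then have "count M = count N \<circ> p" by auto
  then show ?thesis using assms(1) p(1) A unfolding symmetric_series_def by metis
qed

section \<open>Partitions\<close>

abbreviation part_content :: "nat list \<Rightarrow> (nat \<Rightarrow> 'c) \<Rightarrow> 'c multiset" where
  "part_content mu \<equiv> weighted_content {..<length mu} ((!) mu)"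

definition partition_monomial :: "nat list \<Rightarrow> nat multiset" where
  "partition_monomial mu = part_content mu Suc"

lemma is_partition_nth_pos: "is_partition mu \<Longrightarrow> i < length mu \<Longrightarrow> 0 < mu ! i"
  by (simp add: is_partition_def)

lemma set_mset_part_content: "is_partition mu \<Longrightarrow> set_mset (part_content mu f) = f ` {..<length mu}"
  by (intro set_mset_weighted_content) (simp_all add: is_partition_nth_pos)

lemma size_part_content: "size (part_content mu f) = sum_list mu"
  by (simp add: size_weighted_content sum_list_sum_nth atLeast0LessThan)

lemma zero_notin_partition_monomial: "is_partition mu \<Longrightarrow> 0 \<notin># partition_monomial mu"
  by (auto simp: partition_monomial_def set_mset_part_content)

lemma multiplicities_part_content:
  assumes "is_partition mu" "inj_on f {..<length mu}"
  shows "multiplicities (part_content mu f) = mset mu"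
proof -
  have "multiplicities (part_content mu f) =
      image_mset ((!) mu) (mset_set {..<length mu})"
    using assms by (intro multiplicities_weighted_content) (auto simp: is_partition_nth_pos)
  also have "\<dots> = mset (map ((!) mu) [0..<length mu])"
    by (simp only: mset_set_upto_eq_mset_upto mset_map)
  finally show ?thesis by (simp only: map_nth)
qed

lemma multiplicities_partition_monomial:
  "is_partition mu \<Longrightarrow> multiplicities (partition_monomial mu) = mset mu"
  by (simp add: partition_monomial_def multiplicities_part_content)

lemma symmetric_series_partition_monomial:
  assumes "symmetric_series F" "0 \<notin># M" "is_partition mu" "mset mu = multiplicities M"
  shows "F (count M) = F (count (partition_monomial mu))"
  using assms by (intro symmetric_series_multiplicities)
    (simp_all add: multiplicities_partition_monomial zero_notin_partition_monomial)

lemma size_filter_partition_monomial: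
  "size (filter_mset (\<lambda>k. k \<le> i) (partition_monomial mu)) = sum_list (take i mu)"
proof -
  have "{j \<in> {..<length mu}. Suc j \<le> i} = {0..<min i (length mu)}" by auto
  then show ?thesis
    by (simp add: partition_monomial_def filter_mset_weighted_content size_weighted_content
        sum_list_sum_nth min.commute)
qed

lemma is_partition_mset_eq:
  assumes "is_partition mu" "is_partition nu" "mset mu = mset nu"
  shows "mu = nu"
proof -
  have "sorted (rev mu)" "sorted (rev nu)"
    using assms by (simp_all add: is_partition_def sorted_wrt_rev)
  then have "rev mu = rev nu"
    by (metis assms(3) mset_rev properties_for_sort)
  then show ?thesis by simp
qed

lemma ex_partition_multiplicities:
  obtains mu where "is_partition mu" "mset mu = multiplicities M"
proof
  let ?mu = "rev (sorted_list_of_multiset (multiplicities M))"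
  show "mset ?mu = multiplicities M" by simp
  have "sorted_wrt (\<ge>) ?mu" by (simp add: sorted_wrt_rev)
  moreover have "x \<in> set ?mu \<Longrightarrow> 0 < x" for x
    by (auto simp: multiplicities_def)
  ultimately show "is_partition ?mu" by (simp add: is_partition_def)
qed

lemma finite_partitions: "finite {mu. is_partition mu \<and> sum_list mu = n}"
proof (rule finite_subset)
  have "length mu \<le> sum_list mu" if "\<forall>x\<in>set mu. 0 < x" for mu :: "nat list"
    using that by (induction mu) auto
  then show "{mu. is_partition mu \<and> sum_list mu = n} \<subseteq> {mu. set mu \<subseteq> {..n} \<and> length mu \<le> n}"
    by (auto simp: is_partition_def intro: member_le_sum_list)
  show "finite {mu. set mu \<subseteq> {..n} \<and> length mu \<le> n}"
    by (rule finite_lists_length_le) simp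
qed

lemma mcoeff_count:
  assumes "0 \<notin># M"
  shows "mcoeff mu (count M) = of_bool (multiplicities M = mset mu)"
proof -
  have "{k. count M k \<noteq> 0} = set_mset M" by auto
  then show ?thesis using assms by (auto simp: mcoeff_def multiplicities_def not_in_iff)
qed

lemma mcoeff_eq_0:
  assumes "\<nexists>M. \<alpha> = count M \<and> 0 \<notin># M"
  shows "mcoeff mu \<alpha> = 0"
proof -
  have False if "\<alpha> 0 = 0" "finite {k. \<alpha> k \<noteq> 0}"
  proof -
    have "\<alpha> = count (Abs_multiset \<alpha>)" using that(2) by simp
    moreover from this have "0 \<notin># Abs_multiset \<alpha>" using that(1) by (simp add: not_in_iff)
    ultimately show False using assms by blast
  qed
  then show ?thesis by (auto simp: mcoeff_def)
qed

theorem symmetric_series_monomial_expansion: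
  fixes F :: "(nat \<Rightarrow> nat) \<Rightarrow> 'a::comm_ring_1"
  assumes sym: "symmetric_series F" and hom: "homogeneous_series n F"
    and P: "finite P" "\<And>mu. mu \<in> P \<Longrightarrow> is_partition mu"
    and outside: "\<And>mu. is_partition mu \<Longrightarrow> mu \<notin> P \<Longrightarrow> F (count (partition_monomial mu)) = 0"
  shows "F \<alpha> = (\<Sum>mu\<in>P. F (count (partition_monomial mu)) * of_nat (mcoeff mu \<alpha>))"
proof (cases "\<exists>M. \<alpha> = count M \<and> 0 \<notin># M")
  case True
  then obtain M where M: "\<alpha> = count M" "0 \<notin># M" by blast
  obtain nu where nu: "is_partition nu" "mset nu = multiplicities M"
    by (rule ex_partition_multiplicities)
  have "F \<alpha> = F (count (partition_monomial nu))"
    unfolding M(1) by (rule symmetric_series_partition_monomial[OF sym M(2) nu])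
  also have "\<dots> = (\<Sum>mu\<in>P. if mu = nu then F (count (partition_monomial mu)) else 0)"
    using P(1) outside nu(1) by simp
  also have "\<dots> = (\<Sum>mu\<in>P. F (count (partition_monomial mu)) * of_nat (mcoeff mu \<alpha>))"
    unfolding M(1) mcoeff_count[OF M(2)] nu(2)[symmetric]
    using P(2) nu(1) by (intro sum.cong refl) (auto dest: is_partition_mset_eq)
  finally show ?thesis .
next
  case False
  then have "F \<alpha> = 0" using hom by (auto simp: homogeneous_series_def)
  then show ?thesis using mcoeff_eq_0[OF False] by simp
qed

section \<open>Power sums\<close>

definition number_fillings :: "'b set \<Rightarrow> ('b \<Rightarrow> nat) set" where
  "number_fillings J = {\<phi>. (\<forall>u\<in>J. 1 \<le> \<phi> u) \<and> (\<forall>u. u \<notin> J \<longrightarrow> \<phi> u = 0)}"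

lemma finite_number_fillings_content:
  assumes "finite J" "\<And>u. u \<in> J \<Longrightarrow> 0 < m u"
  shows "finite {\<phi> \<in> number_fillings J. weighted_content J m \<phi> = M}"
proof (rule finite_subset)
  show "finite {\<phi>. \<forall>u. (u \<in> J \<longrightarrow> \<phi> u \<in> set_mset M) \<and> (u \<notin> J \<longrightarrow> \<phi> u = 0)}"
    using assms(1) by (rule finite_set_of_finite_funs) simp
  show "{\<phi> \<in> number_fillings J. weighted_content J m \<phi> = M} \<subseteq>
      {\<phi>. \<forall>u. (u \<in> J \<longrightarrow> \<phi> u \<in> set_mset M) \<and> (u \<notin> J \<longrightarrow> \<phi> u = 0)}"
    using assms by (auto simp: number_fillings_def set_mset_weighted_content)
qed

lemma pcoeff_eq_card:
  "pcoeff mu \<alpha> = card {\<phi> \<in> number_fillings {..<length mu}. count (part_content mu \<phi>) = \<alpha>}"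
  unfolding pcoeff_def
  by (rule arg_cong[of _ _ card])
    (auto simp: number_fillings_def count_weighted_content fun_eq_iff)

lemma pcoeff_count:
  "pcoeff mu (count M) = card {\<phi> \<in> number_fillings {..<length mu}. part_content mu \<phi> = M}"
  by (simp add: pcoeff_eq_card count_inject)

lemma pcoeff_nonzeroE:
  assumes "pcoeff mu \<alpha> \<noteq> 0"
  obtains \<phi> where "\<phi> \<in> number_fillings {..<length mu}" "\<alpha> = count (part_content mu \<phi>)"
proof -
  have "{\<phi> \<in> number_fillings {..<length mu}. count (part_content mu \<phi>) = \<alpha>} \<noteq> {}"
    using assms unfolding pcoeff_eq_card by (metis card.empty)
  then show ?thesis using that by blast
qed

lemma pcoeff_nonzero_countE:
  assumes "is_partition mu" "pcoeff mu \<alpha> \<noteq> 0"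
  obtains M where "\<alpha> = count M" "0 \<notin># M" "size M = sum_list mu" "card (set_mset M) \<le> length mu"
proof -
  obtain \<phi> where \<phi>: "\<phi> \<in> number_fillings {..<length mu}" "\<alpha> = count (part_content mu \<phi>)"
    using assms(2) by (rule pcoeff_nonzeroE)
  define M where "M = part_content mu \<phi>"
  have "set_mset M = \<phi> ` {..<length mu}" unfolding M_def
    by (rule set_mset_part_content[OF assms(1)])
  then have "0 \<notin># M" "card (set_mset M) \<le> length mu"
    using \<phi>(1) card_image_le[of "{..<length mu}" \<phi>] by (force simp: number_fillings_def)+
  moreover have "size M = sum_list mu" unfolding M_def by (rule size_part_content)
  ultimately show ?thesis using that \<phi>(2) by (simp add: M_def)
qed

lemma homogeneous_pcoeff: "is_partition mu \<Longrightarrow> homogeneous_series (sum_list mu) (pcoeff mu)"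
  unfolding homogeneous_series_def by (metis pcoeff_nonzero_countE)

lemma pcoeff_count_eq_0:
  assumes "is_partition mu" "card (set_mset M) = length mu" "multiplicities M \<noteq> mset mu"
  shows "pcoeff mu (count M) = 0"
proof (rule ccontr)
  assume "pcoeff mu (count M) \<noteq> 0"
  then obtain \<phi> where M: "M = part_content mu \<phi>"
    by (metis pcoeff_nonzeroE count_inject)
  have "set_mset M = \<phi> ` {..<length mu}" unfolding M by (rule set_mset_part_content[OF assms(1)])
  then have "inj_on \<phi> {..<length mu}" using assms(2) by (intro eq_card_imp_inj_on) auto
  then show False using assms by (simp add: M multiplicities_part_content)
qed

lemma pcoeff_partition_monomial_pos:
  assumes "is_partition mu"
  shows "0 < pcoeff mu (count (partition_monomial mu))"
proof -
  have "(\<lambda>i. if i < length mu then Suc i else 0) \<in>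
      {\<phi> \<in> number_fillings {..<length mu}. part_content mu \<phi> = partition_monomial mu}"
    by (auto simp: number_fillings_def partition_monomial_def intro!: weighted_content_cong)
  moreover have "finite {\<phi> \<in> number_fillings {..<length mu}.
      part_content mu \<phi> = partition_monomial mu}"
    using assms by (intro finite_number_fillings_content) (simp_all add: is_partition_nth_pos)
  ultimately show ?thesis unfolding pcoeff_count card_gt_0_iff by blast
qed

lemma symmetric_pcoeff: "symmetric_series (pcoeff mu)"
  unfolding symmetric_series_def
proof (intro allI impI, elim conjE)
  fix p A \<alpha> assume p: "p permutes A" and A: "(0::nat) \<notin> A"
  define L where "L = {..<length mu}"
  define S where "S = (\<lambda>\<alpha>. {\<phi> \<in> number_fillings L. count (weighted_content L ((!) mu) \<phi>) = \<alpha>})"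
  have rename: "inv r \<circ> \<phi> \<in> S (\<beta> \<circ> r)" if r: "r permutes A" and \<phi>: "\<phi> \<in> S \<beta>" for r \<phi> \<beta>
  proof -
    have inv_eq: "inv r x = y \<longleftrightarrow> x = r y" for x y using permutes_inv_eq[OF r] by metis
    have \<beta>: "\<beta> = count (weighted_content L ((!) mu) \<phi>)" using \<phi> by (simp add: S_def)
    have "inv r x = 0 \<longleftrightarrow> x = 0" for x using permutes_not_in[OF r A] inv_eq[of x 0] by auto
    then have "inv r \<circ> \<phi> \<in> number_fillings L"
      using \<phi> by (simp add: S_def number_fillings_def Suc_le_eq flip: neq0_conv)
    moreover have "count (weighted_content L ((!) mu) (inv r \<circ> \<phi>)) = \<beta> \<circ> r"
      by (simp add: \<beta> L_def count_weighted_content inv_eq fun_eq_iff)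
    ultimately show ?thesis by (simp add: S_def)
  qed
  have "p \<circ> \<phi> \<in> S \<alpha>" if "\<phi> \<in> S (\<alpha> \<circ> p)" for \<phi>
    using rename[OF permutes_inv[OF p] that]
    by (simp add: permutes_inv_inv[OF p] comp_assoc permutes_inv_o[OF p])
  then have "bij_betw (\<lambda>\<phi>. inv p \<circ> \<phi>) (S \<alpha>) (S (\<alpha> \<circ> p))"
    using rename[OF p]
    by (intro bij_betwI[where g = "\<lambda>\<phi>. p \<circ> \<phi>"]) (auto simp: fun_eq_iff permutes_inverses[OF p])
  then show "pcoeff mu (\<alpha> \<circ> p) = pcoeff mu \<alpha>"
    unfolding pcoeff_eq_card S_def L_def by (rule bij_betw_same_card[symmetric])
qed

definition few_variable_series :: "nat \<Rightarrow> nat \<Rightarrow> ((nat \<Rightarrow> nat) \<Rightarrow> 'a::zero) \<Rightarrow> bool" where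
  "few_variable_series n l F \<longleftrightarrow>
     (\<forall>\<alpha>. F \<alpha> \<noteq> 0 \<longrightarrow> (\<exists>M. \<alpha> = count M \<and> 0 \<notin># M \<and> size M = n \<and> card (set_mset M) < l))"

lemma symmetric_diff_pcoeff_sum:
  "symmetric_series F \<Longrightarrow> symmetric_series (\<lambda>\<alpha>. F \<alpha> - (\<Sum>mu\<in>N. b mu * of_nat (pcoeff mu \<alpha>)))"
  using symmetric_pcoeff unfolding symmetric_series_def by simp

lemma sum_pcoeff_count_eq_single:
  fixes b :: "nat list \<Rightarrow> 'a::comm_ring_1"
  assumes M: "0 \<notin># M" "card (set_mset M) = l"
    and N: "finite N" "\<And>mu. mu \<in> N \<Longrightarrow> is_partition mu \<and> length mu = l"
    and nu: "nu \<in> N" "mset nu = multiplicities M"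
  shows "(\<Sum>mu\<in>N. b mu * of_nat (pcoeff mu (count M))) =
    b nu * of_nat (pcoeff nu (count (partition_monomial nu)))"
proof -
  have "pcoeff mu (count M) = 0" if "mu \<in> N - {nu}" for mu
    using that N(2) nu M(2) is_partition_mset_eq[of mu nu] by (intro pcoeff_count_eq_0) auto
  moreover have "pcoeff nu (count M) = pcoeff nu (count (partition_monomial nu))"
    using M(1) N(2) nu by (intro symmetric_series_partition_monomial symmetric_pcoeff) simp_all
  ultimately show ?thesis using N(1) nu(1) by (simp add: sum.remove)
qed

text \<open>The values on monomials in exactly \<open>l\<close> variables are matched by power sums with \<open>l\<close> parts.\<close>

lemma ex_power_sums_reducing_variables:
  fixes F :: "(nat \<Rightarrow> nat) \<Rightarrow> 'a::field_char_0"
  assumes sym: "symmetric_series F" and supp: "few_variable_series n (Suc l) F"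
    and N_def: "N = {mu. is_partition mu \<and> sum_list mu = n \<and> length mu = l}"
  shows "\<exists>b. few_variable_series n l (\<lambda>\<alpha>. F \<alpha> - (\<Sum>mu\<in>N. b mu * of_nat (pcoeff mu \<alpha>)))"
proof -
  define b where "b mu =
      F (count (partition_monomial mu)) / of_nat (pcoeff mu (count (partition_monomial mu)))"
    for mu
  define G where "G = (\<lambda>\<alpha>. F \<alpha> - (\<Sum>mu\<in>N. b mu * of_nat (pcoeff mu \<alpha>)))"
  have finN: "finite N"
    unfolding N_def by (rule finite_subset[OF _ finite_partitions[of n]]) auto
  have "\<exists>M. \<alpha> = count M \<and> 0 \<notin># M \<and> size M = n \<and> card (set_mset M) < l" if "G \<alpha> \<noteq> 0" for \<alpha>
  proof -
    have "F \<alpha> \<noteq> 0 \<or> (\<exists>mu\<in>N. pcoeff mu \<alpha> \<noteq> 0)"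
      using that unfolding G_def
      by (metis (no_types, lifting) diff_self mult_zero_right of_nat_0 sum.neutral)
    then obtain M where M: "\<alpha> = count M" "0 \<notin># M" "size M = n" "card (set_mset M) \<le> l"
      using supp
      by (auto simp: few_variable_series_def N_def less_Suc_eq_le elim!: pcoeff_nonzero_countE)
    have "G \<alpha> = 0" if "card (set_mset M) = l"
    proof -
      obtain nu where nu: "is_partition nu" "mset nu = multiplicities M"
        by (rule ex_partition_multiplicities)
      then have "length nu = l" "sum_list nu = n"
        using that M(3)
        by (metis size_mset size_multiplicities, metis sum_mset_multiplicities sum_mset_sum_list)
      then have "nu \<in> N" using nu by (simp add: N_def)
      then have "(\<Sum>mu\<in>N. b mu * of_nat (pcoeff mu \<alpha>)) =
          b nu * of_nat (pcoeff nu (count (partition_monomial nu)))"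
        unfolding M(1) using finN that nu M(2)
        by (intro sum_pcoeff_count_eq_single) (auto simp: N_def)
      also have "\<dots> = F (count (partition_monomial nu))"
        using pcoeff_partition_monomial_pos[OF nu(1)] by (simp add: b_def)
      also have "\<dots> = F \<alpha>"
        unfolding M(1) by (rule symmetric_series_partition_monomial[OF sym M(2) nu, symmetric])
      finally show ?thesis by (simp add: G_def)
    qed
    then show ?thesis using M that by (metis le_neq_implies_less)
  qed
  then show ?thesis unfolding few_variable_series_def G_def by blast
qed

lemma power_sum_expansion_bounded:
  fixes F :: "(nat \<Rightarrow> nat) \<Rightarrow> 'a::field_char_0"
  assumes "symmetric_series F" "few_variable_series n l F"
  shows "\<exists>a. \<forall>\<alpha>. F \<alpha> =
    (\<Sum>mu | is_partition mu \<and> sum_list mu = n \<and> length mu < l. a mu * of_nat (pcoeff mu \<alpha>))"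
  using assms
proof (induction l arbitrary: F)
  case 0
  then show ?case by (simp add: few_variable_series_def)
next
  case (Suc l)
  define P where "P = (\<lambda>l. {mu. is_partition mu \<and> sum_list mu = n \<and> length mu < l})"
  define N where "N = {mu. is_partition mu \<and> sum_list mu = n \<and> length mu = l}"
  obtain b where b: "few_variable_series n l (\<lambda>\<alpha>. F \<alpha> - (\<Sum>mu\<in>N. b mu * of_nat (pcoeff mu \<alpha>)))"
    using ex_power_sums_reducing_variables[OF Suc.prems N_def] ..
  obtain a where a: "\<forall>\<alpha>. F \<alpha> - (\<Sum>mu\<in>N. b mu * of_nat (pcoeff mu \<alpha>)) =
      (\<Sum>mu\<in>P l. a mu * of_nat (pcoeff mu \<alpha>))"
    using Suc.IH[OF symmetric_diff_pcoeff_sum[OF Suc.prems(1)] b] unfolding P_def ..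
  have fin: "finite (P l)" "finite N"
    unfolding P_def N_def by (rule finite_subset[OF _ finite_partitions[of n]], blast)+
  have P_Suc: "P (Suc l) = P l \<union> N" "P l \<inter> N = {}" by (auto simp: P_def N_def)
  define c where "c = (\<lambda>mu. if mu \<in> N then b mu else a mu)"
  have "F \<alpha> = (\<Sum>mu\<in>P (Suc l). c mu * of_nat (pcoeff mu \<alpha>))" for \<alpha>
  proof -
    have "(\<Sum>mu\<in>P l. c mu * of_nat (pcoeff mu \<alpha>)) = (\<Sum>mu\<in>P l. a mu * of_nat (pcoeff mu \<alpha>))"
      using P_Suc(2) by (intro sum.cong refl) (auto simp: c_def)
    moreover have "(\<Sum>mu\<in>N. c mu * of_nat (pcoeff mu \<alpha>)) = (\<Sum>mu\<in>N. b mu * of_nat (pcoeff mu \<alpha>))"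
      by (simp add: c_def)
    ultimately show ?thesis
      using spec[OF a, of \<alpha>]
      by (simp add: P_Suc(1) sum.union_disjoint[OF fin P_Suc(2)] algebra_simps)
  qed
  then show ?case unfolding P_def by (intro exI[of _ c] allI)
qed

theorem power_sum_expansion:
  fixes F :: "(nat \<Rightarrow> nat) \<Rightarrow> 'a::field_char_0"
  assumes "symmetric_series F" "homogeneous_series n F"
  obtains P a where "finite P" "\<forall>mu\<in>P. is_partition mu"
    "\<forall>\<alpha>. F \<alpha> = (\<Sum>mu\<in>P. a mu * of_nat (pcoeff mu \<alpha>))"
proof -
  define P where "P = {mu. is_partition mu \<and> sum_list mu = n \<and> length mu < Suc n}"
  have card_le: "card (set_mset M) \<le> size M" for M :: "nat multiset"
    unfolding card_eq_sum size_multiset_overloaded_eq by (rule sum_mono) (simp add: Suc_le_eq)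
  have "few_variable_series n (Suc n) F"
    unfolding few_variable_series_def
  proof (intro allI impI)
    fix \<alpha> assume "F \<alpha> \<noteq> 0"
    then obtain M where "\<alpha> = count M" "0 \<notin># M" "size M = n"
      using assms(2) unfolding homogeneous_series_def by blast
    then show "\<exists>M. \<alpha> = count M \<and> 0 \<notin># M \<and> size M = n \<and> card (set_mset M) < Suc n"
      using card_le[of M] by auto
  qed
  from power_sum_expansion_bounded[OF assms(1) this]
  obtain a where "\<forall>\<alpha>. F \<alpha> = (\<Sum>mu\<in>P. a mu * of_nat (pcoeff mu \<alpha>))"
    unfolding P_def ..
  moreover have "finite P"
    unfolding P_def by (rule finite_subset[OF _ finite_partitions[of n]]) blast
  moreover have "\<forall>mu\<in>P. is_partition mu" by (simp add: P_def)
  ultimately show ?thesis by (intro that)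
qed

declare split_paired_All [simp del] split_paired_Ex [simp del]

section \<open>Superization\<close>

definition letter_fillings :: "'b set \<Rightarrow> ('b \<Rightarrow> letter) set" where
  "letter_fillings J = {\<sigma>. (\<forall>u\<in>J. 1 \<le> fst (\<sigma> u)) \<and> (\<forall>u. u \<notin> J \<longrightarrow> \<sigma> u = zero_letter)}"

definition filling_sign :: "'b set \<Rightarrow> ('b \<Rightarrow> letter) \<Rightarrow> 'a::comm_ring_1" where
  "filling_sign J \<sigma> = (-1) ^ card {u\<in>J. snd (\<sigma> u)}"

text \<open>For \<open>m = 1\<close> on the cells of a diagram the following are sums over fillings; for
  \<open>m i = mu ! i\<close> they are coefficients of the power sum \<open>p_mu\<close> in a signed alphabet.\<close>

definition super_sum ::
  "'b set \<Rightarrow> ('b \<Rightarrow> nat) \<Rightarrow> (('b \<Rightarrow> letter) \<Rightarrow> 'a::comm_ring_1) \<Rightarrow> letter multiset \<Rightarrow> 'a" where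
  "super_sum J m W \<kappa> =
     (\<Sum>\<sigma> | \<sigma> \<in> letter_fillings J \<and> weighted_content J m \<sigma> = \<kappa>. filling_sign J \<sigma> * W \<sigma>)"

definition pleth_sum ::
  "'b set \<Rightarrow> ('b \<Rightarrow> nat) \<Rightarrow> (('b \<Rightarrow> letter) \<Rightarrow> 'a::comm_ring_1) \<Rightarrow> 'a \<Rightarrow> nat multiset \<Rightarrow> 'a" where
  "pleth_sum J m W t M =
     (\<Sum>\<sigma> | \<sigma> \<in> letter_fillings J \<and> weighted_content J m (fst \<circ> \<sigma>) = M.
        filling_sign J \<sigma> * t ^ sum m {u\<in>J. \<not> snd (\<sigma> u)} * W \<sigma>)"

definition toggle :: "'b \<Rightarrow> ('b \<Rightarrow> letter) \<Rightarrow> 'b \<Rightarrow> letter" where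
  "toggle p \<sigma> = \<sigma>(p := (fst (\<sigma> p), \<not> snd (\<sigma> p)))"

definition relabelling :: "(letter \<Rightarrow> letter) \<Rightarrow> bool" where
  "relabelling s \<longleftrightarrow> (\<forall>a b. rank1 a < rank1 b \<longrightarrow> rank1 (s a) < rank1 (s b)) \<and>
     (\<forall>a. snd (s a) = snd a) \<and> (\<forall>a. fst (s a) = 0 \<longleftrightarrow> fst a = 0)"

text \<open>Leaves the positive letter of absolute value \<open>k + 1\<close> unused, directly below the image of the
  negative letter of absolute value \<open>k\<close>.\<close>

definition insert_gap :: "nat \<Rightarrow> letter \<Rightarrow> letter" where
  "insert_gap k l = (if rank1 l \<le> 2 * k then l else (Suc (fst l), snd l))"

abbreviation with_letters :: "letter multiset \<Rightarrow> nat \<Rightarrow> nat \<Rightarrow> nat \<Rightarrow> letter multiset" where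
  "with_letters \<kappa> k i j \<equiv> \<kappa> + replicate_mset i (k, False) + replicate_mset j (k, True)"

text \<open>The second condition says that the variables of \<open>X\<close> and \<open>Y\<close> with index \<open>k\<close> cancel in
  \<open>f[X - Y]\<close> when they are set equal.\<close>

definition supersymmetric :: "(letter multiset \<Rightarrow> 'a::ab_group_add) \<Rightarrow> bool" where
  "supersymmetric D \<longleftrightarrow>
     (\<forall>s \<kappa>. relabelling s \<longrightarrow> D (image_mset s \<kappa>) = D \<kappa>) \<and>
     (\<forall>k g \<kappa>. 0 < k \<and> 0 < g \<and> (\<forall>l\<in>#\<kappa>. fst l \<noteq> k) \<longrightarrow>
        (\<Sum>i\<le>g. D (with_letters \<kappa> k i (g - i))) = 0)"

lemma rank1_eq_iff: "rank1 a = rank1 b \<longleftrightarrow> a = b"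
  by (cases a; cases b) (auto simp: rank1_def, presburger+)

lemma relabelling_rank1_less_iff: "relabelling s \<Longrightarrow> rank1 (s a) < rank1 (s b) \<longleftrightarrow> rank1 a < rank1 b"
  unfolding relabelling_def by (metis linorder_less_linear order_less_asym rank1_eq_iff)

lemma relabelling_inj: "relabelling s \<Longrightarrow> inj s"
  unfolding relabelling_def inj_def by (metis linorder_less_linear order_less_irrefl rank1_eq_iff)

lemma relabelling_zero_letter: "relabelling s \<Longrightarrow> s zero_letter = zero_letter"
  by (auto simp: relabelling_def zero_letter_def prod_eq_iff)

lemma relabelling_fst_pos: "relabelling s \<Longrightarrow> 1 \<le> fst (s a) \<longleftrightarrow> 1 \<le> fst a"
  by (simp add: relabelling_def Suc_le_eq flip: neq0_conv)

lemma relabelling_snd: "relabelling s \<Longrightarrow> snd (s a) = snd a"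
  by (simp add: relabelling_def)

lemma size_filter_negative_relabelling:
  "relabelling s \<Longrightarrow> size (filter_mset snd (image_mset s \<kappa>)) = size (filter_mset snd \<kappa>)"
  by (simp add: filter_mset_image_mset relabelling_snd comp_def)

lemma relabelling_insert_gap: "0 < k \<Longrightarrow> relabelling (insert_gap k)"
  by (auto simp: relabelling_def insert_gap_def rank1_def)

lemma insert_gap_neq: "insert_gap k l \<noteq> (Suc k, False)"
  by (cases l) (auto simp: insert_gap_def rank1_def)

lemma letter_fillings_outside: "\<sigma> \<in> letter_fillings J \<Longrightarrow> u \<notin> J \<Longrightarrow> \<sigma> u = zero_letter"
  unfolding letter_fillings_def by blast

lemma letter_fillings_pos: "\<sigma> \<in> letter_fillings J \<Longrightarrow> u \<in> J \<Longrightarrow> 1 \<le> fst (\<sigma> u)"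
  unfolding letter_fillings_def by blast

lemma relabelling_letter_fillings:
  "relabelling s \<Longrightarrow> s \<circ> \<sigma> \<in> letter_fillings J \<longleftrightarrow> \<sigma> \<in> letter_fillings J"
proof -
  assume s: "relabelling s"
  then have "s a = zero_letter \<longleftrightarrow> a = zero_letter" for a
    by (metis injD relabelling_inj relabelling_zero_letter)
  then show ?thesis unfolding letter_fillings_def comp_def mem_Collect_eq relabelling_fst_pos[OF s]
    by simp
qed

lemma fst_toggle [simp]: "fst (toggle p \<sigma> u) = fst (\<sigma> u)"
  by (simp add: toggle_def)

lemma fst_comp_toggle [simp]: "fst \<circ> toggle p \<sigma> = fst \<circ> \<sigma>"
  by (simp add: fun_eq_iff)

lemma toggle_toggle [simp]: "toggle p (toggle p \<sigma>) = \<sigma>"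
  by (simp add: toggle_def)

lemma toggle_letter_fillings: "\<sigma> \<in> letter_fillings J \<Longrightarrow> p \<in> J \<Longrightarrow> toggle p \<sigma> \<in> letter_fillings J"
  by (auto simp: letter_fillings_def toggle_def)

lemma card_negative_toggle:
  assumes "finite J" "p \<in> J" "\<not> snd (\<sigma> p)"
  shows "card {u\<in>J. snd (toggle p \<sigma> u)} = Suc (card {u\<in>J. snd (\<sigma> u)})"
proof -
  have "{u\<in>J. snd (toggle p \<sigma> u)} = insert p {u\<in>J. snd (\<sigma> u)}"
    using assms by (auto simp: toggle_def)
  then show ?thesis using assms by simp
qed

lemma filling_sign_toggle:
  assumes "finite J" "p \<in> J"
  shows "filling_sign J (toggle p \<sigma>) = - filling_sign J \<sigma>"
proof (cases "snd (\<sigma> p)")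
  case True
  then have "\<not> snd (toggle p \<sigma> p)" by (simp add: toggle_def)
  then show ?thesis
    using card_negative_toggle[OF assms, of "toggle p \<sigma>"] by (simp add: filling_sign_def)
qed (simp add: filling_sign_def card_negative_toggle[OF assms])

lemma filling_sign_positive: "\<forall>u\<in>J. \<not> snd (\<sigma> u) \<Longrightarrow> filling_sign J \<sigma> = 1"
  by (simp add: filling_sign_def cong: conj_cong)

lemma sum_sign_reversing:
  fixes f :: "'b \<Rightarrow> 'a::field_char_0"
  assumes "\<And>x. x \<in> B \<Longrightarrow> h x \<in> B" "\<And>x. x \<in> B \<Longrightarrow> h (h x) = x" "\<And>x. x \<in> B \<Longrightarrow> f (h x) = - f x"
  shows "sum f B = 0"
proof -
  have "sum f B = (\<Sum>x\<in>B. - f x)"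
    by (rule sum.reindex_bij_witness[of _ h h]) (use assms in auto)
  then have "2 * sum f B = 0" by (simp add: sum_negf)
  then show ?thesis by simp
qed

lemma finite_letter_fillings_into:
  assumes "finite J" "finite L"
  shows "finite {\<sigma> \<in> letter_fillings J. \<sigma> ` J \<subseteq> L}"
proof (rule finite_subset)
  show "finite {\<sigma>. \<forall>u. (u \<in> J \<longrightarrow> \<sigma> u \<in> L) \<and> (u \<notin> J \<longrightarrow> \<sigma> u = zero_letter)}"
    using assms by (rule finite_set_of_finite_funs)
qed (auto simp: letter_fillings_def)

lemma finite_letter_fillings_abs_content:
  assumes "finite J" "\<And>u. u \<in> J \<Longrightarrow> 0 < m u"
  shows "finite {\<sigma> \<in> letter_fillings J. weighted_content J m (fst \<circ> \<sigma>) = M}"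
proof (rule finite_subset)
  show "{\<sigma> \<in> letter_fillings J. weighted_content J m (fst \<circ> \<sigma>) = M} \<subseteq>
      {\<sigma> \<in> letter_fillings J. \<sigma> ` J \<subseteq> set_mset M \<times> UNIV}"
    using assms by (auto simp: set_mset_weighted_content)
       (metis comp_apply fst_conv image_eqI)
qed (simp add: finite_letter_fillings_into assms(1))

lemma supersymmetric_relabel: "supersymmetric D \<Longrightarrow> relabelling s \<Longrightarrow> D (image_mset s \<kappa>) = D \<kappa>"
  unfolding supersymmetric_def by blast

lemma supersymmetric_cancel:
  assumes "supersymmetric D" "0 < k" "0 < g" "\<forall>l\<in>#\<kappa>. fst l \<noteq> k"
  shows "(\<Sum>i\<le>g. D (with_letters \<kappa> k i (g - i))) = 0"
  using assms unfolding supersymmetric_def by blast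

lemma supersymmetric_diff:
  "supersymmetric D \<Longrightarrow> supersymmetric E \<Longrightarrow> supersymmetric (\<lambda>\<kappa>. D \<kappa> - E \<kappa>)"
  unfolding supersymmetric_def by (simp add: sum_subtractf)

lemma supersymmetric_sum:
  assumes "\<And>x. x \<in> M \<Longrightarrow> supersymmetric (D x)"
  shows "supersymmetric (\<lambda>\<kappa>. \<Sum>x\<in>M. a x * D x \<kappa> :: 'a::comm_ring_1)"
  unfolding supersymmetric_def
proof (intro conjI allI impI; (elim conjE)?)
  show "(\<Sum>x\<in>M. a x * D x (image_mset s \<kappa>)) = (\<Sum>x\<in>M. a x * D x \<kappa>)" if "relabelling s" for s \<kappa>
    using assms that by (intro sum.cong refl) (simp add: supersymmetric_relabel)
  fix k g :: nat and \<kappa> :: "letter multiset"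
  assume kg: "0 < k" "0 < g" "\<forall>l\<in>#\<kappa>. fst l \<noteq> k"
  let ?K = "\<lambda>i. with_letters \<kappa> k i (g - i)"
  have "(\<Sum>i\<le>g. \<Sum>x\<in>M. a x * D x (?K i)) = (\<Sum>x\<in>M. a x * (\<Sum>i\<le>g. D x (?K i)))"
    by (subst sum.swap) (simp add: sum_distrib_left)
  also have "\<dots> = 0" using assms kg by (simp add: supersymmetric_cancel)
  finally show "(\<Sum>i\<le>g. \<Sum>x\<in>M. a x * D x (?K i)) = 0" .
qed

lemma filter_mset_replicate_mset [simp]:
  "filter_mset P (replicate_mset n x) = (if P x then replicate_mset n x else {#})"
  by (induction n) auto

lemma filter_letter_replicate:
  "filter_mset (\<lambda>l. fst l = k) \<kappa> =
     replicate_mset (count \<kappa> (k, False)) (k, False) + replicate_mset (count \<kappa> (k, True)) (k, True)"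
proof (rule multiset_eqI)
  show "count (filter_mset (\<lambda>l. fst l = k) \<kappa>) l =
      count (replicate_mset (count \<kappa> (k, False)) (k, False) +
        replicate_mset (count \<kappa> (k, True)) (k, True)) l" for l
    by (cases l; cases "snd l") auto
qed

lemma image_insert_gap_split:
  fixes k \<kappa>
  defines "\<kappa>' \<equiv> image_mset (insert_gap k) \<kappa>"
  shows "\<kappa>' =
    filter_mset (\<lambda>l. fst l \<noteq> Suc k) \<kappa>' + replicate_mset (count \<kappa>' (Suc k, True)) (Suc k, True)"
proof -
  have "count \<kappa>' (Suc k, False) = 0"
    using insert_gap_neq[symmetric] by (auto simp: \<kappa>'_def simp flip: not_in_iff)
  then show ?thesis
    using multiset_partition[of \<kappa>' "\<lambda>l. fst l = Suc k"]
    by (simp add: filter_letter_replicate add.commute)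
qed

text \<open>Relabelling frees the positive letter below a negative one, and the cancellation law then
  replaces copies of the negative letter by copies of the positive one.\<close>

theorem supersymmetric_eq_0:
  fixes D :: "letter multiset \<Rightarrow> 'a::ab_group_add"
  assumes D: "supersymmetric D"
    and positive: "\<And>\<kappa>. \<forall>l\<in>#\<kappa>. \<not> snd l \<Longrightarrow> \<forall>l\<in>#\<kappa>. 0 < fst l \<Longrightarrow> D \<kappa> = 0"
    and "\<forall>l\<in>#\<kappa>. 0 < fst l"
  shows "D \<kappa> = 0"
  using assms(3)
proof (induction "size (filter_mset snd \<kappa>)" arbitrary: \<kappa> rule: less_induct)
  case less
  show ?case
  proof (cases "\<forall>l\<in>#\<kappa>. \<not> snd l")
    case False
    then obtain k where k: "(k, True) \<in># \<kappa>" by (metis prod.collapse)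
    then have "0 < k" using less.prems by auto
    note gap = relabelling_insert_gap[OF this]
    define \<kappa>' where "\<kappa>' = image_mset (insert_gap k) \<kappa>"
    define \<rho> where "\<rho> = filter_mset (\<lambda>l. fst l \<noteq> Suc k) \<kappa>'"
    define c where "c = count \<kappa>' (Suc k, True)"
    define E where "E i = with_letters \<rho> (Suc k) i (c - i)" for i
    have "(Suc k, True) = insert_gap k (k, True)" by (simp add: insert_gap_def rank1_def)
    then have "(Suc k, True) \<in># \<kappa>'" using k unfolding \<kappa>'_def by (metis image_eqI set_image_mset)
    then have "0 < c" by (simp add: c_def)
    have E0: "E 0 = \<kappa>'"
      using image_insert_gap_split[of k \<kappa>] by (simp add: E_def \<rho>_def c_def \<kappa>'_def)
    have negatives: "size (filter_mset snd \<kappa>) = size (filter_mset snd (E 0))"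
      unfolding E0 \<kappa>'_def by (rule size_filter_negative_relabelling[OF gap, symmetric])
    have pos: "\<forall>l\<in>#\<kappa>'. 0 < fst l"
      using less.prems relabelling_fst_pos[OF gap] by (auto simp: \<kappa>'_def Suc_le_eq)
    have "D (E i) = 0" if "i \<in> {..c} - {0}" for i
    proof (rule less.hyps)
      show "size (filter_mset snd (E i)) < size (filter_mset snd \<kappa>)"
        unfolding negatives using that \<open>0 < c\<close> by (auto simp: E_def)
      show "\<forall>l\<in>#E i. 0 < fst l" using pos by (auto simp: E_def \<rho>_def split: if_splits)
    qed
    then have "(\<Sum>i\<le>c. D (E i)) = D (E 0)" by (subst sum.remove[of _ 0]) auto
    moreover have "(\<Sum>i\<le>c. D (E i)) = 0"
      unfolding E_def using D \<open>0 < c\<close> by (intro supersymmetric_cancel) (auto simp: \<rho>_def)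
    ultimately show ?thesis using E0 supersymmetric_relabel[OF D gap] by (simp add: \<kappa>'_def)
  qed (use positive less.prems in blast)
qed

lemma eq_with_letters_iff:
  assumes "\<forall>l\<in>#\<kappa>. fst l \<noteq> k" "i \<le> g"
  shows "\<mu> = with_letters \<kappa> k i (g - i) \<longleftrightarrow>
    filter_mset (\<lambda>l. fst l \<noteq> k) \<mu> = \<kappa> \<and> size (filter_mset (\<lambda>l. fst l = k) \<mu>) = g \<and>
    count \<mu> (k, False) = i" (is "\<mu> = ?K \<longleftrightarrow> ?R")
proof
  have "filter_mset (\<lambda>l. fst l \<noteq> k) \<kappa> = \<kappa>" "filter_mset (\<lambda>l. fst l = k) \<kappa> = {#}"
    using assms(1) by (simp_all add: filter_mset_eq_conv)
  moreover have "count \<kappa> (k, False) = 0" using assms(1) by (auto simp flip: not_in_iff)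
  ultimately show "?R" if "\<mu> = ?K" using that assms(2) by simp
  show "\<mu> = ?K" if ?R
    using that multiset_partition[of \<mu> "\<lambda>l. fst l = k"]
    by (auto simp: filter_letter_replicate add_ac)
qed

locale superization =
  fixes J :: "'b set" and m :: "'b \<Rightarrow> nat" and W :: "('b \<Rightarrow> letter) \<Rightarrow> 'a::field_char_0"
    and pick :: "'b set \<Rightarrow> 'b"
  assumes finite_cells: "finite J" and weight_pos: "\<And>u. u \<in> J \<Longrightarrow> 0 < m u"
    and pick_in: "\<And>A. A \<subseteq> J \<Longrightarrow> A \<noteq> {} \<Longrightarrow> pick A \<in> A"
    and relabel: "\<And>\<sigma> s. \<sigma> \<in> letter_fillings J \<Longrightarrow> relabelling s \<Longrightarrow> W (s \<circ> \<sigma>) = W \<sigma>"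
    and toggle_pick: "\<And>\<sigma> k. \<sigma> \<in> letter_fillings J \<Longrightarrow> {u\<in>J. fst (\<sigma> u) = k} \<noteq> {} \<Longrightarrow>
       W (toggle (pick {u\<in>J. fst (\<sigma> u) = k}) \<sigma>) = W \<sigma>"
begin

lemma set_mset_content: "set_mset (weighted_content J m f) = f ` J"
  by (simp add: set_mset_weighted_content finite_cells weight_pos)

lemma super_sum_relabel:
  assumes s: "relabelling s"
  shows "super_sum J m W (image_mset s \<kappa>) = super_sum J m W \<kappa>"
proof -
  define S where "S = (\<lambda>\<kappa>. {\<sigma> \<in> letter_fillings J. weighted_content J m \<sigma> = \<kappa>})"
  note inj = relabelling_inj[OF s]
  have iff: "s \<circ> \<sigma> \<in> S (image_mset s \<kappa>) \<longleftrightarrow> \<sigma> \<in> S \<kappa>" for \<sigma>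
    using inj relabelling_letter_fillings[OF s]
    by (auto simp: S_def simp flip: image_mset_weighted_content dest: multiset.inj_map[THEN injD])
  have "inj_on (\<lambda>\<sigma>. s \<circ> \<sigma>) (S \<kappa>)"
    using inj by (auto simp: inj_on_def fun_eq_iff dest: injD)
  moreover have "\<tau> \<in> (\<lambda>\<sigma>. s \<circ> \<sigma>) ` S \<kappa>" if \<tau>: "\<tau> \<in> S (image_mset s \<kappa>)" for \<tau>
  proof -
    have "\<tau> ` J = s ` set_mset \<kappa>"
      using \<tau> set_mset_content[of \<tau>] by (auto simp: S_def)
    then have "\<tau> u \<in> range s" for u
      using \<tau> relabelling_zero_letter[OF s] letter_fillings_outside[of \<tau> J u]
      by (cases "u \<in> J") (auto simp: S_def, metis rangeI)
    then have "\<tau> = s \<circ> (inv s \<circ> \<tau>)" by (simp add: fun_eq_iff f_inv_into_f)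
    then show ?thesis using iff \<tau> by (metis image_eqI)
  qed
  ultimately have "bij_betw (\<lambda>\<sigma>. s \<circ> \<sigma>) (S \<kappa>) (S (image_mset s \<kappa>))"
    using iff unfolding bij_betw_def by blast
  then have "(\<Sum>\<sigma>\<in>S (image_mset s \<kappa>). filling_sign J \<sigma> * W \<sigma>) =
      (\<Sum>\<sigma>\<in>S \<kappa>. filling_sign J (s \<circ> \<sigma>) * W (s \<circ> \<sigma>))"
    by (rule sum.reindex_bij_betw[symmetric])
  also have "\<dots> = (\<Sum>\<sigma>\<in>S \<kappa>. filling_sign J \<sigma> * W \<sigma>)"
    using s by (intro sum.cong refl) (simp add: S_def relabel filling_sign_def relabelling_snd)
  finally show ?thesis by (simp add: super_sum_def S_def)
qed

lemma sum_toggle_pick_eq_0: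
  assumes "0 < g"
  shows "(\<Sum>\<sigma> | \<sigma> \<in> letter_fillings J \<and>
      filter_mset (\<lambda>l. fst l \<noteq> k) (weighted_content J m \<sigma>) = \<kappa> \<and>
      size (filter_mset (\<lambda>l. fst l = k) (weighted_content J m \<sigma>)) = g. filling_sign J \<sigma> * W \<sigma>) = 0"
    (is "sum ?f ?B = 0")
proof (rule sum_sign_reversing)
  fix \<sigma> assume \<sigma>: "\<sigma> \<in> ?B"
  define A where "A = {u\<in>J. fst (\<sigma> u) = k}"
  let ?h = "\<lambda>\<sigma>. toggle (pick {u\<in>J. fst (\<sigma> u) = k}) \<sigma>"
  have "g = sum m A"
    using \<sigma>
    by (auto simp: A_def filter_mset_weighted_content[OF finite_cells] size_weighted_content)
  then have "A \<noteq> {}" using assms by auto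
  then have p: "pick A \<in> J" "fst (\<sigma> (pick A)) = k" using pick_in[of A] by (auto simp: A_def)
  show "?h (?h \<sigma>) = \<sigma>" by simp
  have "filter_mset (\<lambda>l. fst l \<noteq> k) (weighted_content J m (toggle (pick A) \<sigma>)) =
      filter_mset (\<lambda>l. fst l \<noteq> k) (weighted_content J m \<sigma>)"
    unfolding filter_mset_weighted_content[OF finite_cells] fst_toggle
    using p(2) by (intro weighted_content_cong) (auto simp: toggle_def)
  then show "?h \<sigma> \<in> ?B"
    using \<sigma> p(1)
    by (simp add: A_def toggle_letter_fillings size_weighted_content
        filter_mset_weighted_content[OF finite_cells])
  have "W (toggle (pick A) \<sigma>) = W \<sigma>"
    using toggle_pick[of \<sigma> k] \<sigma> \<open>A \<noteq> {}\<close> by (simp add: A_def)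
  then show "?f (?h \<sigma>) = - ?f \<sigma>"
    unfolding A_def[symmetric] by (simp add: filling_sign_toggle[OF finite_cells p(1)])
qed

lemma super_sum_cancel:
  assumes g: "0 < g" and \<kappa>: "\<forall>l\<in>#\<kappa>. fst l \<noteq> k"
  shows "(\<Sum>i\<le>g. super_sum J m W (with_letters \<kappa> k i (g - i))) = 0"
proof -
  define c :: "('b \<Rightarrow> letter) \<Rightarrow> letter multiset" where "c = weighted_content J m"
  define f where "f = (\<lambda>\<sigma>. filling_sign J \<sigma> * W \<sigma>)"
  define B where "B = {\<sigma> \<in> letter_fillings J. filter_mset (\<lambda>l. fst l \<noteq> k) (c \<sigma>) = \<kappa> \<and>
      size (filter_mset (\<lambda>l. fst l = k) (c \<sigma>)) = g}"
  have "\<sigma> ` J \<subseteq> set_mset \<kappa> \<union> {k} \<times> UNIV" if "\<sigma> \<in> B" for \<sigma>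
  proof
    fix l assume "l \<in> \<sigma> ` J"
    then have "l \<in># c \<sigma>" by (simp add: c_def set_mset_content)
    then show "l \<in> set_mset \<kappa> \<union> {k} \<times> UNIV"
      using that by (cases "fst l = k") (auto simp: B_def mem_Times_iff)
  qed
  then have "finite B"
    by (intro finite_subset[OF _ finite_letter_fillings_into[of J "set_mset \<kappa> \<union> {k} \<times> UNIV"]])
      (auto simp: B_def finite_cells)
  have count_le: "count (c \<sigma>) (k, False) \<le> g" if "\<sigma> \<in> B" for \<sigma>
    using that by (auto simp: B_def filter_letter_replicate)
  have "(\<Sum>i\<le>g. super_sum J m W (with_letters \<kappa> k i (g - i))) =
      (\<Sum>i\<le>g. sum f {\<sigma>\<in>B. count (c \<sigma>) (k, False) = i})"
    unfolding super_sum_def f_def c_def[symmetric]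
    by (intro sum.cong refl) (auto simp: B_def eq_with_letters_iff[OF \<kappa>])
  also have "\<dots> = sum f B" using \<open>finite B\<close> count_le by (intro sum.group) auto
  also have "\<dots> = 0" unfolding f_def B_def c_def by (rule sum_toggle_pick_eq_0[OF g])
  finally show ?thesis .
qed

lemma supersymmetric_super_sum: "supersymmetric (super_sum J m W)"
  unfolding supersymmetric_def using super_sum_relabel super_sum_cancel by blast

lemma pleth_sum_eq_super_sum:
  "pleth_sum J m W t M = (\<Sum>\<kappa> | image_mset fst \<kappa> = M.
     t ^ size (filter_mset (\<lambda>l. \<not> snd l) \<kappa>) * super_sum J m W \<kappa>)"
proof -
  define S where "S = {\<sigma> \<in> letter_fillings J. weighted_content J m (fst \<circ> \<sigma>) = M}"
  define T where "T = {\<kappa> :: letter multiset. image_mset fst \<kappa> = M}"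
  define f where "f = (\<lambda>\<sigma>. filling_sign J \<sigma> * t ^ sum m {u\<in>J. \<not> snd (\<sigma> u)} * W \<sigma>)"
  have "finite S"
    unfolding S_def by (rule finite_letter_fillings_abs_content[of J m, OF finite_cells weight_pos])
  moreover have "finite T"
  proof (rule finite_subset)
    show "T \<subseteq> multisets_of_size (set_mset M \<times> UNIV) (size M)"
      by (force simp: T_def multisets_of_size_def)
  qed auto
  moreover have "weighted_content J m ` S \<subseteq> T"
    by (auto simp: S_def T_def image_mset_weighted_content)
  ultimately have "sum f S = (\<Sum>\<kappa>\<in>T. sum f {\<sigma>\<in>S. weighted_content J m \<sigma> = \<kappa>})"
    by (rule sum.group[symmetric])
  also have "\<dots> = (\<Sum>\<kappa>\<in>T. t ^ size (filter_mset (\<lambda>l. \<not> snd l) \<kappa>) * super_sum J m W \<kappa>)"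
  proof (rule sum.cong[OF refl])
    fix \<kappa> assume "\<kappa> \<in> T"
    then have "{\<sigma>\<in>S. weighted_content J m \<sigma> = \<kappa>} =
        {\<sigma> \<in> letter_fillings J. weighted_content J m \<sigma> = \<kappa>}"
      by (auto simp: S_def T_def simp flip: image_mset_weighted_content)
    moreover have "size (filter_mset (\<lambda>l. \<not> snd l) (weighted_content J m \<sigma>)) =
        sum m {u\<in>J. \<not> snd (\<sigma> u)}"
      for \<sigma> :: "'b \<Rightarrow> letter"
      by (simp add: filter_mset_weighted_content[OF finite_cells] size_weighted_content)
    ultimately show "sum f {\<sigma>\<in>S. weighted_content J m \<sigma> = \<kappa>} =
        t ^ size (filter_mset (\<lambda>l. \<not> snd l) \<kappa>) * super_sum J m W \<kappa>"
      by (auto simp: super_sum_def f_def sum_distrib_left mult_ac intro!: sum.cong)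
  qed
  finally show ?thesis by (simp add: pleth_sum_def S_def T_def f_def)
qed

end

lemma super_sum_positive:
  fixes W :: "('b \<Rightarrow> letter) \<Rightarrow> 'a::comm_ring_1"
  assumes "finite J" "\<And>u. u \<in> J \<Longrightarrow> 0 < m u" "\<forall>l\<in>#\<kappa>. \<not> snd l"
  shows "super_sum J m W \<kappa> = (\<Sum>\<sigma> | \<sigma> \<in> letter_fillings J \<and> (\<forall>u\<in>J. \<not> snd (\<sigma> u)) \<and>
    weighted_content J m (fst \<circ> \<sigma>) = image_mset fst \<kappa>. W \<sigma>)"
proof -
  have "weighted_content J m \<sigma> = \<kappa> \<longleftrightarrow> (\<forall>u\<in>J. \<not> snd (\<sigma> u)) \<and>
      weighted_content J m (fst \<circ> \<sigma>) = image_mset fst \<kappa>" for \<sigma>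
  proof
    assume "weighted_content J m \<sigma> = \<kappa>"
    then show "(\<forall>u\<in>J. \<not> snd (\<sigma> u)) \<and> weighted_content J m (fst \<circ> \<sigma>) = image_mset fst \<kappa>"
      using assms set_mset_weighted_content[of J m \<sigma>, OF assms(1,2)]
      by (auto simp flip: image_mset_weighted_content)
  next
    assume \<sigma>: "(\<forall>u\<in>J. \<not> snd (\<sigma> u)) \<and> weighted_content J m (fst \<circ> \<sigma>) = image_mset fst \<kappa>"
    then have "weighted_content J m \<sigma> = weighted_content J m ((\<lambda>k. (k, False)) \<circ> (fst \<circ> \<sigma>))"
      by (intro weighted_content_cong) (simp add: prod_eq_iff)
    also have "\<dots> = image_mset (\<lambda>k. (k, False)) (image_mset fst \<kappa>)"
      using \<sigma> by (simp only: flip: image_mset_weighted_content)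
    also have "\<dots> = image_mset id \<kappa>"
      unfolding multiset.map_comp using assms(3) by (intro image_mset_cong) (simp add: prod_eq_iff)
    finally show "weighted_content J m \<sigma> = \<kappa>" by simp
  qed
  then show ?thesis
    unfolding super_sum_def by (intro sum.cong) (auto simp: filling_sign_positive)
qed

lemma bij_betw_letter_fillings:
  "bij_betw (\<lambda>(\<phi>, N) u. (\<phi> u, u \<in> N)) (number_fillings J \<times> Pow J) (letter_fillings J)"
proof (rule bij_betwI[where g = "\<lambda>\<sigma>. (fst \<circ> \<sigma>, {u\<in>J. snd (\<sigma> u)})"])
  show "(\<lambda>\<sigma>. (fst \<circ> \<sigma>, {u\<in>J. snd (\<sigma> u)})) \<in> letter_fillings J \<rightarrow> number_fillings J \<times> Pow J"
    by (auto simp: letter_fillings_def number_fillings_def zero_letter_def)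
  show "(\<lambda>(\<phi>, N) u. (\<phi> u, u \<in> N)) \<in> number_fillings J \<times> Pow J \<rightarrow> letter_fillings J"
    by (auto simp: letter_fillings_def number_fillings_def zero_letter_def)
  show "(\<lambda>(\<phi>, N) u. (\<phi> u, u \<in> N)) (fst \<circ> \<sigma>, {u\<in>J. snd (\<sigma> u)}) = \<sigma>" if "\<sigma> \<in> letter_fillings J" for \<sigma>
    using letter_fillings_outside[OF that] by (auto simp: fun_eq_iff prod_eq_iff zero_letter_def)
qed auto

lemma pleth_sum_one:
  fixes t :: "'a::comm_ring_1"
  assumes "finite J"
  shows "pleth_sum J m (\<lambda>_. 1) t M =
    (\<Prod>u\<in>J. t ^ m u - 1) * of_nat (card {\<phi> \<in> number_fillings J. weighted_content J m \<phi> = M})"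
proof -
  define P where "P = {\<phi> \<in> number_fillings J. weighted_content J m \<phi> = M}"
  define S where "S = {\<sigma> \<in> letter_fillings J. weighted_content J m (fst \<circ> \<sigma>) = M}"
  define f where "f = (\<lambda>\<sigma>. filling_sign J \<sigma> * t ^ sum m {u\<in>J. \<not> snd (\<sigma> u)})"
  define h :: "('b \<Rightarrow> nat) \<times> 'b set \<Rightarrow> 'b \<Rightarrow> letter" where "h = (\<lambda>(\<phi>, N) u. (\<phi> u, u \<in> N))"
  have bij: "bij_betw h (number_fillings J \<times> Pow J) (letter_fillings J)"
    unfolding h_def by (rule bij_betw_letter_fillings)
  have "fst \<circ> h x = fst x" for x by (auto simp: h_def fun_eq_iff split: prod.split)
  then have "h ` (P \<times> Pow J) = S"
    unfolding S_def P_def bij_betw_imp_surj_on[OF bij, symmetric] by (auto simp: image_iff)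
  moreover have "inj_on h (P \<times> Pow J)"
    by (rule inj_on_subset[OF bij_betw_imp_inj_on[OF bij]]) (auto simp: P_def)
  ultimately have "bij_betw h (P \<times> Pow J) S" by (simp add: bij_betw_def)
  then have "sum f S = (\<Sum>x\<in>P \<times> Pow J. f (h x))" by (rule sum.reindex_bij_betw[symmetric])
  also have "\<dots> = (\<Sum>\<phi>\<in>P. \<Sum>N\<in>Pow J. f (h (\<phi>, N)))" by (simp add: sum.cartesian_product)
  also have "\<dots> = (\<Sum>\<phi>\<in>P. \<Sum>N\<in>Pow J. (\<Prod>u\<in>N. - 1) * (\<Prod>u\<in>J - N. t ^ m u))"
  proof (intro sum.cong refl)
    fix \<phi> N assume "N \<in> Pow J"
    then have "{u\<in>J. u \<in> N} = N" "{u\<in>J. u \<notin> N} = J - N" by auto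
    then show "f (h (\<phi>, N)) = (\<Prod>u\<in>N. - 1) * (\<Prod>u\<in>J - N. t ^ m u)"
      by (simp add: f_def h_def filling_sign_def power_sum)
  qed
  also have "\<dots> = of_nat (card P) * (\<Prod>u\<in>J. - 1 + t ^ m u)"
    unfolding prod_add[OF assms] by (rule sum_constant)
  finally show ?thesis by (simp add: pleth_sum_def S_def P_def f_def mult.commute)
qed

lemma superization_power_sum:
  assumes "is_partition mu"
  shows "superization {..<length mu} ((!) mu) (\<lambda>_. 1 :: 'a::field_char_0) (\<lambda>A. SOME x. x \<in> A)"
  using assms by unfold_locales (auto simp: is_partition_nth_pos some_in_eq)

lemma super_sum_power_sum:
  assumes "is_partition mu" "\<forall>l\<in>#\<kappa>. \<not> snd l"
  shows "super_sum {..<length mu} ((!) mu) (\<lambda>_. 1) \<kappa> =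
    (of_nat (pcoeff mu (count (image_mset fst \<kappa>))) :: 'a::comm_ring_1)"
proof -
  define L where "L = {..<length mu}"
  define S where "S = {\<sigma> \<in> letter_fillings L. (\<forall>u\<in>L. \<not> snd (\<sigma> u)) \<and>
      weighted_content L ((!) mu) (fst \<circ> \<sigma>) = image_mset fst \<kappa>}"
  have "bij_betw (\<lambda>\<sigma>. fst \<circ> \<sigma>) S
      {\<phi> \<in> number_fillings L. weighted_content L ((!) mu) \<phi> = image_mset fst \<kappa>}"
  proof (rule bij_betwI[where g = "\<lambda>\<phi> u. (\<phi> u, False)"])
    show "(\<lambda>u. ((fst \<circ> \<sigma>) u, False)) = \<sigma>" if "\<sigma> \<in> S" for \<sigma>
    proof
      show "((fst \<circ> \<sigma>) u, False) = \<sigma> u" for u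
        using that letter_fillings_outside[of \<sigma> L u]
        by (cases "u \<in> L") (auto simp: S_def prod_eq_iff zero_letter_def)
    qed
  qed (auto simp: S_def letter_fillings_def number_fillings_def zero_letter_def comp_def)
  then have "card S = pcoeff mu (count (image_mset fst \<kappa>))"
    unfolding pcoeff_count L_def by (rule bij_betw_same_card)
  moreover have "super_sum L ((!) mu) (\<lambda>_. 1) \<kappa> = (\<Sum>\<sigma>\<in>S. 1 :: 'a)"
    unfolding S_def using assms
    by (subst super_sum_positive) (auto simp: L_def is_partition_nth_pos)
  ultimately show ?thesis by (simp add: L_def)
qed

theorem (in superization) pleth_sum_power_sum_expansion:
  assumes P: "finite P" "\<forall>mu\<in>P. is_partition mu"
    and positive: "\<And>\<kappa>. \<forall>l\<in>#\<kappa>. \<not> snd l \<Longrightarrow>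
      super_sum J m W \<kappa> = (\<Sum>mu\<in>P. a mu * of_nat (pcoeff mu (count (image_mset fst \<kappa>))))"
    and M: "0 \<notin># M"
  shows "pleth_sum J m W t M =
    (\<Sum>mu\<in>P. a mu * (\<Prod>i<length mu. t ^ (mu ! i) - 1) * of_nat (pcoeff mu (count M)))"
proof -
  define p :: "nat list \<Rightarrow> letter multiset \<Rightarrow> 'a"
    where "p = (\<lambda>mu. super_sum {..<length mu} ((!) mu) (\<lambda>_. 1))"
  define D where "D = (\<lambda>\<kappa>. super_sum J m W \<kappa> - (\<Sum>mu\<in>P. a mu * p mu \<kappa>))"
  define T where "T = {\<kappa> :: letter multiset. image_mset fst \<kappa> = M}"
  define e where "e \<kappa> = t ^ size (filter_mset (\<lambda>l. \<not> snd l) \<kappa>)" for \<kappa> :: "letter multiset"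
  have "supersymmetric (p mu)" if "mu \<in> P" for mu
    unfolding p_def using superization_power_sum[OF bspec[OF P(2) that]]
    by (rule superization.supersymmetric_super_sum)
  then have "supersymmetric D"
    unfolding D_def by (rule supersymmetric_diff[OF supersymmetric_super_sum supersymmetric_sum])
  moreover have "D \<kappa> = 0" if "\<forall>l\<in>#\<kappa>. \<not> snd l" for \<kappa>
    using positive[OF that] P(2) that by (simp add: D_def p_def super_sum_power_sum)
  ultimately have "D \<kappa> = 0" if "\<kappa> \<in> T" for \<kappa>
  proof (rule supersymmetric_eq_0[of D])
    show "\<forall>l\<in>#\<kappa>. 0 < fst l"
    proof
      fix l assume "l \<in># \<kappa>"
      then have "fst l \<in># M" using that by (auto simp: T_def)
      then show "0 < fst l" using M by (metis gr0I)
    qed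
  qed
  then have "pleth_sum J m W t M = (\<Sum>\<kappa>\<in>T. \<Sum>mu\<in>P. a mu * (e \<kappa> * p mu \<kappa>))"
    unfolding pleth_sum_eq_super_sum T_def[symmetric] e_def[symmetric]
    by (intro sum.cong refl) (simp add: D_def sum_distrib_left mult_ac)
  also have "\<dots> = (\<Sum>mu\<in>P. a mu * (\<Sum>\<kappa>\<in>T. e \<kappa> * p mu \<kappa>))"
    by (subst sum.swap) (simp add: sum_distrib_left)
  also have "\<dots> = (\<Sum>mu\<in>P. a mu * pleth_sum {..<length mu} ((!) mu) (\<lambda>_. 1) t M)"
    using P(2) by (intro sum.cong refl arg_cong2[where f = "(*)"])
      (simp add: superization.pleth_sum_eq_super_sum[OF superization_power_sum] T_def e_def p_def)
  finally show ?thesis by (simp add: pleth_sum_one pcoeff_count mult.assoc)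
qed

section \<open>The quinv statistic in the reading order\<close>

definition cell_above :: "nat \<times> nat \<Rightarrow> nat \<times> nat" where
  "cell_above v = (Suc (fst v), snd v)"

text \<open>Earlier in the reading order (rows from top to bottom, each row from right to left) means
  lexicographically larger, so a cell attacks exactly the cells strictly between itself and the cell
  directly below it.\<close>

definition attacks :: "nat \<times> nat \<Rightarrow> nat \<times> nat \<Rightarrow> bool" where
  "attacks u v \<longleftrightarrow> fst u = fst v \<and> snd v < snd u \<or> fst u = Suc (fst v) \<and> snd u < snd v"

definition row_pairs :: "nat list \<Rightarrow> ((nat \<times> nat) \<times> (nat \<times> nat)) set" where
  "row_pairs lam = {(v, w) \<in> dg lam \<times> dg lam. fst v = fst w \<and> snd v < snd w}"

definition quinv_pair :: "(nat \<times> nat \<Rightarrow> letter) \<Rightarrow> nat \<times> nat \<Rightarrow> nat \<times> nat \<Rightarrow> bool" where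
  "quinv_pair \<sigma> v w \<longleftrightarrow>
     exactly_one (Iv (\<sigma> (cell_above v)) (\<sigma> v)) (\<not> Iv (\<sigma> w) (\<sigma> v)) (\<not> Iv (\<sigma> (cell_above v)) (\<sigma> w))"

definition attack_inversions ::
  "nat list \<Rightarrow> (nat \<times> nat \<Rightarrow> letter) \<Rightarrow> ((nat \<times> nat) \<times> (nat \<times> nat)) set" where
  "attack_inversions lam \<sigma> = {(u, v) \<in> dg lam \<times> dg lam. attacks u v \<and> Iv (\<sigma> u) (\<sigma> v)}"

definition arm :: "nat list \<Rightarrow> nat \<times> nat \<Rightarrow> nat" where
  "arm lam u = card {w \<in> dg lam. fst u = Suc (fst w) \<and> snd u < snd w}"

abbreviation abs_content :: "nat list \<Rightarrow> (nat \<times> nat \<Rightarrow> letter) \<Rightarrow> nat multiset" where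
  "abs_content lam \<sigma> \<equiv> weighted_content (dg lam) (\<lambda>_. 1) (fst \<circ> \<sigma>)"

definition filling_weight ::
  "nat list \<Rightarrow> 'a::comm_ring_1 \<Rightarrow> 'a \<Rightarrow> (nat \<times> nat \<Rightarrow> letter) \<Rightarrow> 'a" where
  "filling_weight lam q t \<sigma> = q ^ maj lam \<sigma> * t ^ quinv lam \<sigma>"

lemma attacks_less: "attacks u v \<or> u = cell_above v \<Longrightarrow> v < u"
  by (cases u; cases v) (auto simp: attacks_def cell_above_def)

lemma attacks_between: "attacks u v \<or> u = cell_above v \<Longrightarrow> v < x \<Longrightarrow> x < u \<Longrightarrow> attacks u x \<and> attacks x v"
  by (cases u; cases v; cases x) (auto simp: attacks_def cell_above_def)

lemma Iv_iff: "Iv a b \<longleftrightarrow> fst b < fst a \<or> fst a = fst b \<and> snd a"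
  by (cases a; cases b) (auto simp: Iv_def rank1_def)

lemma Iv_relabelling: "relabelling s \<Longrightarrow> Iv (s a) (s b) = Iv a b"
  using relabelling_inj[of s]
  by (auto simp: Iv_def relabelling_rank1_less_iff relabelling_snd dest: injD)

lemma not_Iv_zero_letter: "1 \<le> fst b \<Longrightarrow> \<not> Iv zero_letter b"
  by (simp add: Iv_iff zero_letter_def)

lemma exactly_one_Iv:
  "of_bool (exactly_one (Iv a b) (\<not> Iv c b) (\<not> Iv a c)) + of_bool (Iv a b) =
   of_bool (Iv c b) + (of_bool (Iv a c) :: nat)"
  by (auto simp: Iv_iff exactly_one_def)

lemma finite_dg: "finite (dg lam)"
proof (rule finite_subset)
  show "dg lam \<subseteq> {..sum_list lam} \<times> {..length lam}"
  proof
    fix u assume "u \<in> dg lam"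
    then obtain r i where u: "u = (r, i)" "1 \<le> i" "i \<le> length lam" "r \<le> lam ! (i - 1)"
      by (auto simp: dg_def col_ht_def)
    have "lam ! (i - 1) \<le> sum_list lam" using u by (intro member_le_sum_list nth_mem) auto
    then show "u \<in> {..sum_list lam} \<times> {..length lam}" using u by auto
  qed
qed simp

lemma finite_row_pairs: "finite (row_pairs lam)"
  by (rule finite_subset[of _ "dg lam \<times> dg lam"]) (auto simp: row_pairs_def finite_dg)

lemma finite_attack_inversions: "finite (attack_inversions lam \<sigma>)"
  by (rule finite_subset[of _ "dg lam \<times> dg lam"]) (auto simp: attack_inversions_def finite_dg)

lemma finite_descents: "finite {u. is_descent lam \<sigma> u}"
  by (rule finite_subset[OF _ finite_dg[of lam]]) (auto simp: is_descent_def)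

lemma dg_row_pos: "u \<in> dg lam \<Longrightarrow> 1 \<le> fst u"
  by (auto simp: dg_def)

lemma dg_if_cell_above_dg: "cell_above v \<in> dg lam \<Longrightarrow> 1 \<le> fst v \<Longrightarrow> v \<in> dg lam"
  by (cases v) (auto simp: dg_def cell_above_def)

lemma superfillings_eq_letter_fillings: "superfillings lam = letter_fillings (dg lam)"
  by (simp add: superfillings_def letter_fillings_def)

lemma content_eq_count: "content lam \<sigma> = count (abs_content lam \<sigma>)"
  by (simp add: content_def count_weighted_content finite_dg fun_eq_iff)

lemma is_descent_iff:
  "is_descent lam \<sigma> u \<longleftrightarrow> u \<in> dg lam \<and> (\<exists>v\<in>dg lam. u = cell_above v \<and> Iv (\<sigma> u) (\<sigma> v))"
proof
  assume des: "is_descent lam \<sigma> u"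
  define v where "v = (fst u - 1, snd u)"
  have "u = cell_above v" "1 \<le> fst v" using des
    by (auto simp: is_descent_def cell_above_def v_def prod_eq_iff)
  moreover have "u \<in> dg lam" "Iv (\<sigma> u) (\<sigma> v)" using des by (auto simp: is_descent_def v_def)
  ultimately show "u \<in> dg lam \<and> (\<exists>v\<in>dg lam. u = cell_above v \<and> Iv (\<sigma> u) (\<sigma> v))"
    using dg_if_cell_above_dg[of v lam] by auto
next
  assume "u \<in> dg lam \<and> (\<exists>v\<in>dg lam. u = cell_above v \<and> Iv (\<sigma> u) (\<sigma> v))"
  then show "is_descent lam \<sigma> u" by (auto simp: is_descent_def cell_above_def dest: dg_row_pos)
qed

lemma cell_above_dg_if_Iv:
  assumes "\<sigma> \<in> letter_fillings (dg lam)" "w \<in> dg lam" "Iv (\<sigma> (cell_above v)) (\<sigma> w)"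
  shows "cell_above v \<in> dg lam"
  using assms letter_fillings_outside letter_fillings_pos not_Iv_zero_letter by metis

lemma quinv_eq_card_row_pairs:
  assumes \<sigma>: "\<sigma> \<in> letter_fillings (dg lam)"
  shows "quinv lam \<sigma> = card {(v, w) \<in> row_pairs lam. quinv_pair \<sigma> v w}"
proof -
  define f where "f = (\<lambda>(r, i, j). ((r, i), (r, j)) :: (nat \<times> nat) \<times> (nat \<times> nat))"
  define P where "P = {(v, w) \<in> row_pairs lam. quinv_pair \<sigma> v w}"
  have top: "(if u \<in> dg lam then \<sigma> u else zero_letter) = \<sigma> u" for u
    using letter_fillings_outside[OF \<sigma>] by simp
  have degenerate: "(r, i) \<in> dg lam \<Longrightarrow> (Suc r, i) \<in> dg lam \<or> col_ht lam i = r" for r i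
    by (auto simp: dg_def)
  have "is_quinv_triple lam \<sigma> (r, i, j) \<longleftrightarrow> f (r, i, j) \<in> P" for r i j
    using degenerate[of r i]
    unfolding is_quinv_triple_def Let_def Suc_eq_plus1[symmetric] top
    by (auto simp: row_pairs_def f_def P_def quinv_pair_def cell_above_def)
  then have "{x. is_quinv_triple lam \<sigma> x} = f -` P" by (auto simp: f_def)
  moreover have "P \<subseteq> range f"
  proof
    fix y assume "y \<in> P"
    then have "fst (fst y) = fst (snd y)" by (auto simp: P_def row_pairs_def)
    then have "y = f (fst (fst y), snd (fst y), snd (snd y))" by (simp add: f_def prod_eq_iff)
    then show "y \<in> range f" by (rule range_eqI)
  qed
  ultimately have "f ` {x. is_quinv_triple lam \<sigma> x} = P" by (simp add: image_vimage_eq Int_absorb2)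
  moreover have "card (f ` {x. is_quinv_triple lam \<sigma> x}) = quinv lam \<sigma>"
    unfolding quinv_def by (rule card_image) (auto simp: inj_on_def f_def)
  ultimately show ?thesis by (simp add: P_def)
qed

lemma quinv_balance:
  assumes "\<sigma> \<in> letter_fillings (dg lam)"
  shows "quinv lam \<sigma> + card {(v, w) \<in> row_pairs lam. Iv (\<sigma> (cell_above v)) (\<sigma> v)} =
    card {(v, w) \<in> row_pairs lam. Iv (\<sigma> w) (\<sigma> v)} +
    card {(v, w) \<in> row_pairs lam. Iv (\<sigma> (cell_above v)) (\<sigma> w)}"
proof -
  have card_eq: "card {(v, w) \<in> row_pairs lam. P v w} =
      (\<Sum>x\<in>row_pairs lam. of_bool (P (fst x) (snd x)))" for P
    using finite_row_pairs[of lam] by (simp add: split_def sum.If_cases of_bool_def Int_def)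
  show ?thesis
    unfolding quinv_eq_card_row_pairs[OF assms] card_eq sum.distrib[symmetric] quinv_pair_def
      exactly_one_Iv ..
qed

lemma card_row_inversions:
  "card {(v, w) \<in> row_pairs lam. Iv (\<sigma> w) (\<sigma> v)} =
    card {(u, v) \<in> attack_inversions lam \<sigma>. fst u = fst v}"
  by (rule bij_betw_same_card[of prod.swap], rule bij_betwI[where g = prod.swap])
    (auto simp: row_pairs_def attack_inversions_def attacks_def)

lemma cell_above_fst_snd: "fst u = Suc (fst w) \<Longrightarrow> cell_above (fst w, snd u) = u"
  by (simp add: cell_above_def prod_eq_iff)

lemma dg_below: "u \<in> dg lam \<Longrightarrow> w \<in> dg lam \<Longrightarrow> fst u = Suc (fst w) \<Longrightarrow> (fst w, snd u) \<in> dg lam"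
  using dg_if_cell_above_dg[of "(fst w, snd u)" lam] dg_row_pos[of w lam]
  by (simp add: cell_above_fst_snd)

lemma card_cross_inversions:
  assumes "\<sigma> \<in> letter_fillings (dg lam)"
  shows "card {(v, w) \<in> row_pairs lam. Iv (\<sigma> (cell_above v)) (\<sigma> w)} =
    card {(u, v) \<in> attack_inversions lam \<sigma>. fst u \<noteq> fst v}" (is "card ?A = card ?B")
proof (rule bij_betw_same_card, rule bij_betwI)
  show "map_prod cell_above id \<in> ?A \<rightarrow> ?B"
  proof
    fix x assume "x \<in> ?A"
    then obtain v w where x: "x = (v, w)" "(v, w) \<in> row_pairs lam" "Iv (\<sigma> (cell_above v)) (\<sigma> w)"
      by auto
    then have "cell_above v \<in> dg lam"
      using cell_above_dg_if_Iv[OF assms, of w v] by (simp add: row_pairs_def)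
    then show "map_prod cell_above id x \<in> ?B"
      using x by (auto simp: row_pairs_def attack_inversions_def attacks_def cell_above_def)
  qed
  show "(\<lambda>(u, w). ((fst w, snd u), w)) \<in> ?B \<rightarrow> ?A"
  proof
    fix y assume "y \<in> ?B"
    then obtain u w where "y = (u, w)" "u \<in> dg lam" "w \<in> dg lam" "fst u = Suc (fst w)"
        "snd u < snd w" "Iv (\<sigma> u) (\<sigma> w)"
      by (auto simp: attack_inversions_def attacks_def)
    then show "(\<lambda>(u, w). ((fst w, snd u), w)) y \<in> ?A"
      using dg_below[of u lam w] by (simp add: row_pairs_def cell_above_fst_snd)
  qed
  show "(\<lambda>(u, w). ((fst w, snd u), w)) (map_prod cell_above id x) = x" if "x \<in> ?A" for x
    using that by (auto simp: row_pairs_def cell_above_def prod_eq_iff)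
  show "map_prod cell_above id ((\<lambda>(u, w). ((fst w, snd u), w)) y) = y" if "y \<in> ?B" for y
    using that by (auto simp: attack_inversions_def attacks_def cell_above_def)
qed

lemma card_descent_pairs:
  assumes "\<sigma> \<in> letter_fillings (dg lam)"
  shows "card {(v, w) \<in> row_pairs lam. Iv (\<sigma> (cell_above v)) (\<sigma> v)} =
    (\<Sum>u | is_descent lam \<sigma> u. arm lam u)"
    (is "card ?A = _")
proof -
  let ?B = "SIGMA u:{u. is_descent lam \<sigma> u}. {w \<in> dg lam. fst u = Suc (fst w) \<and> snd u < snd w}"
  have "card ?A = card ?B"
  proof (rule bij_betw_same_card, rule bij_betwI)
    show "map_prod cell_above id \<in> ?A \<rightarrow> ?B"
    proof
      fix x assume "x \<in> ?A"
      then obtain v w where x: "x = (v, w)" "(v, w) \<in> row_pairs lam" "Iv (\<sigma> (cell_above v)) (\<sigma> v)"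
        by auto
      then have "is_descent lam \<sigma> (cell_above v)"
        using cell_above_dg_if_Iv[OF assms, of v v] unfolding is_descent_iff
        by (auto simp: row_pairs_def)
      then show "map_prod cell_above id x \<in> ?B"
        using x by (auto simp: row_pairs_def cell_above_def)
    qed
    show "(\<lambda>(u, w). ((fst w, snd u), w)) \<in> ?B \<rightarrow> ?A"
      by (auto simp: row_pairs_def is_descent_iff cell_above_def)
    show "(\<lambda>(u, w). ((fst w, snd u), w)) (map_prod cell_above id x) = x" if "x \<in> ?A" for x
      using that by (auto simp: row_pairs_def cell_above_def prod_eq_iff)
    show "map_prod cell_above id ((\<lambda>(u, w). ((fst w, snd u), w)) y) = y" if "y \<in> ?B" for y
      using that by (auto simp: cell_above_def)
  qed
  also have "\<dots> = (\<Sum>u | is_descent lam \<sigma> u. arm lam u)"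
    unfolding arm_def by (intro card_SigmaI finite_descents ballI) (simp add: finite_dg)
  finally show ?thesis .
qed

theorem quinv_add_arms:
  assumes "\<sigma> \<in> letter_fillings (dg lam)"
  shows "quinv lam \<sigma> + (\<Sum>u | is_descent lam \<sigma> u. arm lam u) = card (attack_inversions lam \<sigma>)"
proof -
  have "card (attack_inversions lam \<sigma>) =
      card {(u, v) \<in> attack_inversions lam \<sigma>. fst u = fst v} +
      card {(u, v) \<in> attack_inversions lam \<sigma>. fst u \<noteq> fst v}"
    by (subst card_Un_disjoint[symmetric])
      (auto intro!: arg_cong[of _ _ card] finite_subset[OF _ finite_attack_inversions[of lam \<sigma>]])
  then show ?thesis
    using quinv_balance[OF assms] card_row_inversions[of lam \<sigma>] card_cross_inversions[OF assms]
      card_descent_pairs[OF assms] by simp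
qed

lemma filling_weight_cong:
  assumes "\<sigma> \<in> letter_fillings (dg lam)" "\<tau> \<in> letter_fillings (dg lam)"
    and Iv: "\<And>u v. u \<in> dg lam \<Longrightarrow> v \<in> dg lam \<Longrightarrow> v < u \<Longrightarrow> Iv (\<sigma> u) (\<sigma> v) = Iv (\<tau> u) (\<tau> v)"
  shows "filling_weight lam q t \<sigma> = filling_weight lam q t \<tau>"
proof -
  have des: "is_descent lam \<sigma> u = is_descent lam \<tau> u" for u
    unfolding is_descent_iff using Iv attacks_less by blast
  have "attack_inversions lam \<sigma> = attack_inversions lam \<tau>"
    unfolding attack_inversions_def using Iv attacks_less by blast
  then have "quinv lam \<sigma> = quinv lam \<tau>"
    using quinv_add_arms[OF assms(1)] quinv_add_arms[OF assms(2)] des by simp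
  then show ?thesis using des by (simp add: filling_weight_def maj_def)
qed

lemma superization_filling_weight:
  "superization (dg lam) (\<lambda>_. 1) (filling_weight lam q t :: _ \<Rightarrow> 'a::field_char_0) Min"
proof
  show "finite (dg lam)" by (rule finite_dg)
  show "Min A \<in> A" if "A \<subseteq> dg lam" "A \<noteq> {}" for A
    using that finite_dg by (meson Min_in finite_subset)
next
  fix \<sigma> s assume "\<sigma> \<in> letter_fillings (dg lam)" "relabelling s"
  then show "filling_weight lam q t (s \<circ> \<sigma>) = filling_weight lam q t \<sigma>"
    by (intro filling_weight_cong) (simp_all add: relabelling_letter_fillings Iv_relabelling)
next
  fix \<sigma> k assume \<sigma>: "\<sigma> \<in> letter_fillings (dg lam)" and ne: "{u \<in> dg lam. fst (\<sigma> u) = k} \<noteq> {}"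
  define p where "p = Min {u \<in> dg lam. fst (\<sigma> u) = k}"
  have fin: "finite {u \<in> dg lam. fst (\<sigma> u) = k}" by (simp add: finite_dg)
  have p: "p \<in> dg lam" "fst (\<sigma> p) = k" using Min_in[OF fin ne] by (auto simp: p_def)
  have last: "fst (\<sigma> v) \<noteq> k" if "v \<in> dg lam" "v < p" for v
    using Min_le[OF fin, of v] that by (auto simp: p_def)
  have "Iv (toggle p \<sigma> u) (toggle p \<sigma> v) = Iv (\<sigma> u) (\<sigma> v)" if "v \<in> dg lam" "v < u" for u v
    using last[of v] that p by (cases "u = p") (auto simp: Iv_iff toggle_def)
  then have "filling_weight lam q t (toggle p \<sigma>) = filling_weight lam q t \<sigma>"
    using \<sigma> p(1) by (intro filling_weight_cong toggle_letter_fillings) auto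
  then show "filling_weight lam q t (toggle (Min {u \<in> dg lam. fst (\<sigma> u) = k}) \<sigma>) =
      filling_weight lam q t \<sigma>"
    by (simp only: p_def)
qed simp

lemma super_sum_eq_C_ser:
  assumes "\<forall>l\<in>#\<kappa>. \<not> snd l"
  shows "super_sum (dg lam) (\<lambda>_. 1) (filling_weight lam q t) \<kappa> =
    C_ser lam q t (count (image_mset fst \<kappa>))"
  unfolding super_sum_positive[OF finite_dg zero_less_one assms] C_ser_def filling_weight_def
  by (intro sum.cong refl)
    (simp add: content_eq_count count_inject posfillings_def superfillings_eq_letter_fillings)

section \<open>Symmetry of the positive generating function\<close>

definition cell_weight :: "nat list \<Rightarrow> 'a::field \<Rightarrow> 'a \<Rightarrow> nat \<times> nat \<Rightarrow> nat \<times> nat \<Rightarrow> 'a" where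
  "cell_weight lam q t u v =
     (if attacks u v then t
      else if u = cell_above v then q ^ (leg lam u + 1) / t ^ arm lam u else 1)"

definition cells_with :: "nat list \<Rightarrow> nat \<Rightarrow> (nat \<times> nat \<Rightarrow> letter) \<Rightarrow> (nat \<times> nat) set" where
  "cells_with lam k \<sigma> = {u \<in> dg lam. fst (\<sigma> u) = k}"

definition raise_cells :: "nat \<Rightarrow> (nat \<times> nat) set \<Rightarrow> (nat \<times> nat \<Rightarrow> letter) \<Rightarrow> nat \<times> nat \<Rightarrow> letter" where
  "raise_cells k S \<tau> u = (if u \<in> S then (Suc k, False) else \<tau> u)"

definition merge_letters :: "nat \<Rightarrow> (nat \<times> nat \<Rightarrow> letter) \<Rightarrow> nat \<times> nat \<Rightarrow> letter" where
  "merge_letters k \<sigma> u = (if fst (\<sigma> u) = Suc k then (k, False) else \<sigma> u)"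

definition raised_weight_sum ::
  "nat list \<Rightarrow> 'a::comm_ring_1 \<Rightarrow> 'a \<Rightarrow> nat \<Rightarrow> (nat \<Rightarrow> nat) \<Rightarrow> (nat \<times> nat \<Rightarrow> letter) \<Rightarrow> 'a" where
  "raised_weight_sum lam q t k \<alpha> \<tau> =
     (\<Sum>S | S \<subseteq> cells_with lam k \<tau> \<and> content lam (raise_cells k S \<tau>) = \<alpha>.
        filling_weight lam q t (raise_cells k S \<tau>))"

lemma interval_weight_cell_weight: "interval_weight t V (cell_weight lam q t)"
  unfolding interval_weight_def
proof (intro ballI impI)
  fix u v assume "cell_weight lam q t u v \<noteq> 1"
  then have related: "attacks u v \<or> u = cell_above v"
    by (auto simp: cell_weight_def split: if_splits)
  have "cell_weight lam q t u x = t \<and> cell_weight lam q t x v = t" if "v < x" "x < u" for x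
    using attacks_between[OF related that] by (simp add: cell_weight_def)
  then show "v < u \<and> (\<forall>x\<in>V. v < x \<and> x < u \<longrightarrow>
      cell_weight lam q t u x = t \<and> cell_weight lam q t x v = t)"
    using attacks_less[OF related] by blast
qed

lemma prod_prod_filter:
  assumes "finite A" "finite B"
  shows "(\<Prod>u\<in>A. \<Prod>v\<in>B. if P u v then f u v else 1) =
    (\<Prod>x\<in>{x \<in> A \<times> B. P (fst x) (snd x)}. f (fst x) (snd x))"
proof -
  have "(\<Prod>u\<in>A. \<Prod>v\<in>B. if P u v then f u v else 1) =
      (\<Prod>x\<in>A \<times> B. if P (fst x) (snd x) then f (fst x) (snd x) else 1)"
    by (simp add: prod.cartesian_product split_def)
  also have "\<dots> = (\<Prod>x\<in>{x \<in> A \<times> B. P (fst x) (snd x)}. f (fst x) (snd x))"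
    using assms by (intro prod.inter_filter[symmetric]) simp
  finally show ?thesis .
qed

lemma prod_descents:
  "(\<Prod>u\<in>dg lam. \<Prod>v\<in>dg lam. if u = cell_above v \<and> Iv (\<sigma> u) (\<sigma> v) then f u else 1) =
    (\<Prod>u | is_descent lam \<sigma> u. f u)"
proof -
  define X where "X =
    {x \<in> dg lam \<times> dg lam. fst x = cell_above (snd x) \<and> Iv (\<sigma> (fst x)) (\<sigma> (snd x))}"
  have "(\<Prod>u\<in>dg lam. \<Prod>v\<in>dg lam. if u = cell_above v \<and> Iv (\<sigma> u) (\<sigma> v) then f u else 1) =
      (\<Prod>x\<in>X. f (fst x))"
    unfolding prod_prod_filter[OF finite_dg finite_dg] X_def ..
  also have "\<dots> = (\<Prod>u\<in>fst ` X. f u)"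
  proof -
    have "inj_on fst X" by (auto simp: X_def inj_on_def cell_above_def)
    then show ?thesis by (simp add: prod.reindex)
  qed
  also have "fst ` X = {u. is_descent lam \<sigma> u}" by (force simp: X_def is_descent_iff image_iff)
  finally show ?thesis .
qed

lemma filling_weight_eq_prod:
  fixes q t :: "'a::field"
  assumes "t \<noteq> 0" "\<sigma> \<in> letter_fillings (dg lam)"
  shows "filling_weight lam q t \<sigma> =
    (\<Prod>u\<in>dg lam. \<Prod>v\<in>dg lam. if Iv (\<sigma> u) (\<sigma> v) then cell_weight lam q t u v else 1)"
proof -
  define d where "d = (\<lambda>u. q ^ (leg lam u + 1) / t ^ arm lam u)"
  define A where "A = (\<Sum>u | is_descent lam \<sigma> u. arm lam u)"
  have "\<not> attacks (cell_above v) v" for v by (auto simp: attacks_def cell_above_def)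
  then have "(\<Prod>u\<in>dg lam. \<Prod>v\<in>dg lam. if Iv (\<sigma> u) (\<sigma> v) then cell_weight lam q t u v else 1) =
      (\<Prod>u\<in>dg lam. \<Prod>v\<in>dg lam. if attacks u v \<and> Iv (\<sigma> u) (\<sigma> v) then t else 1) *
      (\<Prod>u\<in>dg lam. \<Prod>v\<in>dg lam. if u = cell_above v \<and> Iv (\<sigma> u) (\<sigma> v) then d u else 1)"
    unfolding prod.distrib[symmetric] by (intro prod.cong refl) (auto simp: cell_weight_def d_def)
  also have "(\<Prod>u\<in>dg lam. \<Prod>v\<in>dg lam. if attacks u v \<and> Iv (\<sigma> u) (\<sigma> v) then t else 1) =
      t ^ card (attack_inversions lam \<sigma>)"
    unfolding prod_prod_filter[OF finite_dg finite_dg] prod_constant attack_inversions_def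
    by (intro arg_cong[of _ _ "\<lambda>A. t ^ card A"]) auto
  also have "(\<Prod>u\<in>dg lam. \<Prod>v\<in>dg lam. if u = cell_above v \<and> Iv (\<sigma> u) (\<sigma> v) then d u else 1) =
      (\<Prod>u | is_descent lam \<sigma> u. d u)"
    by (rule prod_descents)
  also have "\<dots> = q ^ maj lam \<sigma> / t ^ A"
    unfolding d_def prod_dividef maj_def A_def by (simp only: power_sum)
  also have "t ^ card (attack_inversions lam \<sigma>) = t ^ quinv lam \<sigma> * t ^ A"
    unfolding quinv_add_arms[OF assms(2), symmetric] A_def by (rule power_add)
  finally show ?thesis using assms(1) by (simp add: filling_weight_def)
qed

lemma posfillings_iff: "\<sigma> \<in> posfillings lam \<longleftrightarrow> \<sigma> \<in> letter_fillings (dg lam) \<and> (\<forall>u. \<not> snd (\<sigma> u))"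
proof -
  have "\<not> snd (\<sigma> u)" if "\<sigma> \<in> letter_fillings (dg lam)" "\<forall>u\<in>dg lam. \<not> snd (\<sigma> u)" for u
    using letter_fillings_outside[OF that(1), of u] that(2)
    by (cases "u \<in> dg lam") (auto simp: zero_letter_def)
  then show ?thesis by (auto simp: posfillings_def superfillings_eq_letter_fillings)
qed

lemma finite_posfillings_content: "finite {\<sigma> \<in> posfillings lam. content lam \<sigma> = \<alpha>}"
proof (cases "\<exists>M. \<alpha> = count M")
  case True
  then obtain M where M: "\<alpha> = count M" by blast
  have "{\<sigma> \<in> posfillings lam. content lam \<sigma> = \<alpha>} \<subseteq>
      {\<sigma> \<in> letter_fillings (dg lam). abs_content lam \<sigma> = M}"
    by (auto simp: M posfillings_iff content_eq_count count_inject)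
  then show ?thesis
    by (rule finite_subset) (rule finite_letter_fillings_abs_content[OF finite_dg zero_less_one])
next
  case False
  then have "{\<sigma> \<in> posfillings lam. content lam \<sigma> = \<alpha>} = {}" by (auto simp: content_eq_count)
  then show ?thesis by (simp only: finite.emptyI)
qed

lemma finite_cells_with: "finite (cells_with lam k \<sigma>)"
  by (simp add: cells_with_def finite_dg)

lemma content_eq_card_cells_with: "content lam \<sigma> k = card (cells_with lam k \<sigma>)"
  by (simp add: content_def cells_with_def)

lemma raise_cells_posfillings:
  assumes "\<tau> \<in> posfillings lam" "S \<subseteq> cells_with lam k \<tau>"
  shows "raise_cells k S \<tau> \<in> posfillings lam"
  using assms by (auto simp: posfillings_iff letter_fillings_def raise_cells_def cells_with_def)

lemma merge_letters_posfillings: "\<sigma> \<in> posfillings lam \<Longrightarrow> 1 \<le> k \<Longrightarrow> merge_letters k \<sigma> \<in> posfillings lam"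
  by (auto simp: posfillings_iff letter_fillings_def merge_letters_def zero_letter_def)

lemma cells_with_Suc_merge_letters: "cells_with lam (Suc k) (merge_letters k \<sigma>) = {}"
  by (auto simp: cells_with_def merge_letters_def split: if_splits)

lemma cells_with_Suc_raise_cells:
  assumes "S \<subseteq> cells_with lam k \<tau>" "cells_with lam (Suc k) \<tau> = {}"
  shows "cells_with lam (Suc k) (raise_cells k S \<tau>) = S"
  using assms by (auto simp: cells_with_def raise_cells_def)

lemma merge_raise_cells:
  assumes "\<tau> \<in> posfillings lam" "S \<subseteq> cells_with lam k \<tau>" "cells_with lam (Suc k) \<tau> = {}"
  shows "merge_letters k (raise_cells k S \<tau>) = \<tau>"
proof
  fix u
  have "fst (\<tau> u) \<noteq> Suc k"
    using assms(1,3) by (cases "u \<in> dg lam")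
      (auto simp: cells_with_def posfillings_iff letter_fillings_def zero_letter_def)
  moreover have "\<tau> u = (k, False)" if "u \<in> S"
    using assms(1,2) that by (auto simp: cells_with_def posfillings_iff prod_eq_iff)
  ultimately show "merge_letters k (raise_cells k S \<tau>) u = \<tau> u"
    by (auto simp: merge_letters_def raise_cells_def)
qed

lemma raise_merge_letters:
  assumes "\<sigma> \<in> posfillings lam"
  shows "raise_cells k (cells_with lam (Suc k) \<sigma>) (merge_letters k \<sigma>) = \<sigma>"
proof
  fix u
  show "raise_cells k (cells_with lam (Suc k) \<sigma>) (merge_letters k \<sigma>) u = \<sigma> u"
    using assms by (cases "u \<in> dg lam")
      (auto simp: raise_cells_def merge_letters_def cells_with_def posfillings_iff
        letter_fillings_def zero_letter_def prod_eq_iff)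
qed

lemma bij_betw_raise_cells:
  assumes "\<tau> \<in> posfillings lam" "cells_with lam (Suc k) \<tau> = {}"
  shows "bij_betw (\<lambda>S. raise_cells k S \<tau>) (Pow (cells_with lam k \<tau>))
    {\<sigma> \<in> posfillings lam. merge_letters k \<sigma> = \<tau>}"
proof (rule bij_betwI[where g = "cells_with lam (Suc k)"])
  show "(\<lambda>S. raise_cells k S \<tau>) \<in> Pow (cells_with lam k \<tau>) \<rightarrow>
      {\<sigma> \<in> posfillings lam. merge_letters k \<sigma> = \<tau>}"
    using assms by (auto simp: raise_cells_posfillings merge_raise_cells)
  show "cells_with lam (Suc k) \<in> {\<sigma> \<in> posfillings lam. merge_letters k \<sigma> = \<tau>} \<rightarrow>
      Pow (cells_with lam k \<tau>)"
    by (auto simp: cells_with_def merge_letters_def)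
  show "cells_with lam (Suc k) (raise_cells k S \<tau>) = S" if "S \<in> Pow (cells_with lam k \<tau>)" for S
    using that assms(2) by (simp add: cells_with_Suc_raise_cells)
  show "raise_cells k (cells_with lam (Suc k) \<sigma>) \<tau> = \<sigma>"
    if "\<sigma> \<in> {\<sigma> \<in> posfillings lam. merge_letters k \<sigma> = \<tau>}" for \<sigma>
    using that raise_merge_letters by auto
qed

lemma content_raise_cells:
  assumes "S \<subseteq> cells_with lam k \<tau>" "cells_with lam (Suc k) \<tau> = {}"
  shows "content lam (raise_cells k S \<tau>) =
    (content lam \<tau>)(k := card (cells_with lam k \<tau> - S), Suc k := card S)"
proof
  fix i
  consider "i = k" | "i = Suc k" | "i \<noteq> k" "i \<noteq> Suc k" by blast
  then have "cells_with lam i (raise_cells k S \<tau>) =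
      (if i = Suc k then S else if i = k then cells_with lam k \<tau> - S else cells_with lam i \<tau>)"
    using assms by cases (auto simp: cells_with_def raise_cells_def)
  then show "content lam (raise_cells k S \<tau>) i =
      ((content lam \<tau>)(k := card (cells_with lam k \<tau> - S), Suc k := card S)) i"
    by (simp add: content_eq_card_cells_with)
qed

lemma Iv_raise_cells:
  assumes \<tau>: "\<tau> \<in> posfillings lam" "cells_with lam (Suc k) \<tau> = {}" and S: "S \<subseteq> cells_with lam k \<tau>"
    and uv: "u \<in> dg lam" "v \<in> dg lam"
  shows "Iv (raise_cells k S \<tau> u) (raise_cells k S \<tau> v) \<longleftrightarrow>
      Iv (\<tau> u) (\<tau> v) \<or> u \<in> S \<and> v \<in> cells_with lam k \<tau> - S"
    and "u \<in> S \<Longrightarrow> v \<in> cells_with lam k \<tau> - S \<Longrightarrow> \<not> Iv (\<tau> u) (\<tau> v)"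
proof -
  define V where "V = cells_with lam k \<tau>"
  have "\<not> snd (\<tau> u)" "fst (\<tau> u) \<noteq> Suc k" "fst (\<tau> v) \<noteq> Suc k" "fst (\<tau> u) = k \<longleftrightarrow> u \<in> V"
      "fst (\<tau> v) = k \<longleftrightarrow> v \<in> V" "S \<subseteq> V"
    using \<tau> S uv by (auto simp: posfillings_iff cells_with_def V_def)
  then show "Iv (raise_cells k S \<tau> u) (raise_cells k S \<tau> v) \<longleftrightarrow>
      Iv (\<tau> u) (\<tau> v) \<or> u \<in> S \<and> v \<in> cells_with lam k \<tau> - S"
    and "u \<in> S \<Longrightarrow> v \<in> cells_with lam k \<tau> - S \<Longrightarrow> \<not> Iv (\<tau> u) (\<tau> v)"
    unfolding V_def[symmetric] by (auto simp: Iv_iff raise_cells_def)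
qed

lemma filling_weight_raise_cells:
  fixes q t :: "'a::field"
  assumes "t \<noteq> 0" and \<tau>: "\<tau> \<in> posfillings lam" "cells_with lam (Suc k) \<tau> = {}"
    and S: "S \<subseteq> cells_with lam k \<tau>"
  shows "filling_weight lam q t (raise_cells k S \<tau>) =
    filling_weight lam q t \<tau> * cut_weight (cell_weight lam q t) (cells_with lam k \<tau>) S"
proof -
  define D where "D = dg lam"
  define V where "V = cells_with lam k \<tau>"
  define w where "w = cell_weight lam q t"
  have fills: "\<tau> \<in> letter_fillings (dg lam)" "raise_cells k S \<tau> \<in> letter_fillings (dg lam)"
    using \<tau>(1) raise_cells_posfillings[OF \<tau>(1) S] by (simp_all add: posfillings_iff)
  have "(\<Prod>u\<in>D. \<Prod>v\<in>D. if Iv (raise_cells k S \<tau> u) (raise_cells k S \<tau> v) then w u v else 1) =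
      (\<Prod>u\<in>D. \<Prod>v\<in>D. if Iv (\<tau> u) (\<tau> v) then w u v else 1) *
      (\<Prod>u\<in>D. \<Prod>v\<in>D. if u \<in> S \<and> v \<in> V - S then w u v else 1)"
    unfolding prod.distrib[symmetric]
    using Iv_raise_cells[OF \<tau> S] by (intro prod.cong refl) (auto simp: V_def D_def)
  also have "(\<Prod>u\<in>D. \<Prod>v\<in>D. if u \<in> S \<and> v \<in> V - S then w u v else 1) = cut_weight w V S"
  proof -
    have "{x \<in> D \<times> D. fst x \<in> S \<and> snd x \<in> V - S} = S \<times> (V - S)"
      using S by (auto simp: V_def D_def cells_with_def)
    then show ?thesis
      unfolding D_def prod_prod_filter[OF finite_dg finite_dg] cut_weight_def
      by (simp only: prod.cartesian_product split_def)
  qed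
  finally show ?thesis
    unfolding filling_weight_eq_prod[OF assms(1) fills(1), of q]
      filling_weight_eq_prod[OF assms(1) fills(2), of q] D_def w_def V_def .
qed

lemma raised_weight_sum_eq_cut_weight_sum:
  fixes q t :: "'a::field"
  assumes "t \<noteq> 0" "\<tau> \<in> posfillings lam" "cells_with lam (Suc k) \<tau> = {}"
  defines "V \<equiv> cells_with lam k \<tau>"
  shows "raised_weight_sum lam q t k \<alpha> \<tau> = filling_weight lam q t \<tau> *
    (\<Sum>S\<in>Pow V. of_bool (content lam (raise_cells k S \<tau>) = \<alpha>) *
      cut_weight (cell_weight lam q t) V S)"
proof -
  have "raised_weight_sum lam q t k \<alpha> \<tau> = (\<Sum>S\<in>Pow V.
      if content lam (raise_cells k S \<tau>) = \<alpha>
      then filling_weight lam q t (raise_cells k S \<tau>) else 0)"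
    by (simp add: raised_weight_sum_def V_def finite_cells_with sum.inter_filter[symmetric])
  also have "\<dots> = (\<Sum>S\<in>Pow V. filling_weight lam q t \<tau> *
      (of_bool (content lam (raise_cells k S \<tau>) = \<alpha>) * cut_weight (cell_weight lam q t) V S))"
    using filling_weight_raise_cells[OF assms(1-3), of _ q]
    by (intro sum.cong refl) (auto simp: V_def)
  finally show ?thesis by (simp add: sum_distrib_left)
qed

lemma fun_upd_eq_comp_transpose_iff:
  assumes "a \<noteq> b"
  shows "f(a := x, b := y) = g \<circ> transpose a b \<longleftrightarrow> f(a := y, b := x) = g"
proof -
  have "f(a := x, b := y) = f(a := y, b := x) \<circ> transpose a b"
    using assms by (auto simp: fun_eq_iff transpose_def)
  then show ?thesis by (metis comp_assoc comp_id transpose_comp_involutory)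
qed

lemma raised_weight_sum_transpose:
  fixes q t :: "'a::field"
  assumes "t \<noteq> 0" and \<tau>: "\<tau> \<in> posfillings lam" "cells_with lam (Suc k) \<tau> = {}"
  shows "raised_weight_sum lam q t k (\<alpha> \<circ> transpose k (Suc k)) \<tau> = raised_weight_sum lam q t k \<alpha> \<tau>"
proof -
  define V where "V = cells_with lam k \<tau>"
  define g :: "nat \<Rightarrow> 'a" where
    "g n = of_bool ((content lam \<tau>)(k := card V - n, Suc k := n) = \<alpha>)" for n
  have finV: "finite V" by (simp add: V_def finite_cells_with)
  have diff: "card (V - S) = card V - card S" "card V - (card V - card S) = card S"
    if "S \<in> Pow V" for S
    using that finV card_mono[of V S] by (auto simp: card_Diff_subset finite_subset)
  have "of_bool (content lam (raise_cells k S \<tau>) = \<alpha>) = g (card S)"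
      "of_bool (content lam (raise_cells k S \<tau>) = \<alpha> \<circ> transpose k (Suc k)) = g (card (V - S))"
    if "S \<in> Pow V" for S
    using that \<tau>(2) diff[OF that]
    by (simp_all add: V_def content_raise_cells g_def fun_upd_eq_comp_transpose_iff)
  then show ?thesis
    using sum_cut_weight_complement[OF finV interval_weight_cell_weight, where g = g]
    by (simp add: raised_weight_sum_eq_cut_weight_sum[OF assms] V_def)
qed

lemma C_ser_eq_sum_raised_weight_sum:
  assumes "finite T" and T: "\<And>\<tau>. \<tau> \<in> T \<Longrightarrow> \<tau> \<in> posfillings lam \<and> cells_with lam (Suc k) \<tau> = {}"
    and merge_letters: "\<And>\<sigma>. \<sigma> \<in> posfillings lam \<Longrightarrow> content lam \<sigma> = \<alpha> \<Longrightarrow> merge_letters k \<sigma> \<in> T"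
  shows "C_ser lam q t \<alpha> = (\<Sum>\<tau>\<in>T. raised_weight_sum lam q t k \<alpha> \<tau>)"
proof -
  define F where "F = {\<sigma> \<in> posfillings lam. content lam \<sigma> = \<alpha>}"
  have "C_ser lam q t \<alpha> = sum (filling_weight lam q t) F"
    by (simp add: C_ser_def F_def filling_weight_def)
  also have "\<dots> = (\<Sum>\<tau>\<in>T. sum (filling_weight lam q t) {\<sigma> \<in> F. merge_letters k \<sigma> = \<tau>})"
    using finite_posfillings_content[of lam \<alpha>] \<open>finite T\<close> merge_letters
    by (intro sum.group[symmetric]) (auto simp: F_def)
  also have "\<dots> = (\<Sum>\<tau>\<in>T. raised_weight_sum lam q t k \<alpha> \<tau>)"
  proof (rule sum.cong[OF refl])
    fix \<tau> assume "\<tau> \<in> T"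
    define P where "P = {S. S \<subseteq> cells_with lam k \<tau> \<and> content lam (raise_cells k S \<tau>) = \<alpha>}"
    have bij: "bij_betw (\<lambda>S. raise_cells k S \<tau>) (Pow (cells_with lam k \<tau>))
        {\<sigma> \<in> posfillings lam. merge_letters k \<sigma> = \<tau>}"
      using T[OF \<open>\<tau> \<in> T\<close>] by (intro bij_betw_raise_cells) simp_all
    have "(\<lambda>S. raise_cells k S \<tau>) ` P =
        {\<sigma> \<in> (\<lambda>S. raise_cells k S \<tau>) ` Pow (cells_with lam k \<tau>). content lam \<sigma> = \<alpha>}"
      unfolding P_def by blast
    also have "\<dots> = {\<sigma> \<in> F. merge_letters k \<sigma> = \<tau>}"
      unfolding bij_betw_imp_surj_on[OF bij] F_def by blast
    finally have image: "(\<lambda>S. raise_cells k S \<tau>) ` P = {\<sigma> \<in> F. merge_letters k \<sigma> = \<tau>}" .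
    have "inj_on (\<lambda>S. raise_cells k S \<tau>) P"
      by (rule inj_on_subset[OF bij_betw_imp_inj_on[OF bij]]) (auto simp: P_def)
    then show "sum (filling_weight lam q t) {\<sigma> \<in> F. merge_letters k \<sigma> = \<tau>} =
        raised_weight_sum lam q t k \<alpha> \<tau>"
      unfolding image[symmetric] raised_weight_sum_def P_def[symmetric] by (simp add: sum.reindex)
  qed
  finally show ?thesis .
qed

lemma C_ser_transpose:
  fixes q t :: "'a::field"
  assumes "t \<noteq> 0" "1 \<le> k"
  shows "C_ser lam q t (\<alpha> \<circ> transpose k (Suc k)) = C_ser lam q t \<alpha>"
proof -
  define T where "T = merge_letters k ` ({\<sigma> \<in> posfillings lam. content lam \<sigma> = \<alpha>} \<union>
    {\<sigma> \<in> posfillings lam. content lam \<sigma> = \<alpha> \<circ> transpose k (Suc k)})"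
  have fin: "finite T" by (simp add: T_def finite_posfillings_content)
  have T: "\<tau> \<in> posfillings lam \<and> cells_with lam (Suc k) \<tau> = {}" if "\<tau> \<in> T" for \<tau>
    using that assms(2) by (auto simp: T_def merge_letters_posfillings cells_with_Suc_merge_letters)
  have "C_ser lam q t \<beta> = (\<Sum>\<tau>\<in>T. raised_weight_sum lam q t k \<beta> \<tau>)"
    if "\<beta> \<in> {\<alpha>, \<alpha> \<circ> transpose k (Suc k)}" for \<beta>
    by (rule C_ser_eq_sum_raised_weight_sum[OF fin T]) (use that in \<open>auto simp: T_def\<close>)
  then show ?thesis
    using T by (auto simp: raised_weight_sum_transpose[OF assms(1)] intro!: sum.cong)
qed

lemma poly_C_ser: "poly (C_ser lam [:q:] [:0, 1:] \<alpha>) x = C_ser lam q (x :: 'a::field_char_0) \<alpha>"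
  by (simp add: C_ser_def poly_sum)

theorem symmetric_C_ser: "symmetric_series (C_ser lam q (t :: 'a::field_char_0))"
proof (rule symmetric_series_if_adjacent)
  fix \<alpha> and k :: nat assume k: "1 \<le> k"
  define p where
    "p = C_ser lam [:q:] [:0, 1:] (\<alpha> \<circ> transpose k (Suc k)) - C_ser lam [:q:] [:0, 1:] \<alpha>"
  have "UNIV - {0} \<subseteq> {x. poly p x = 0}"
    using C_ser_transpose[OF _ k, of _ lam q \<alpha>] by (auto simp: p_def poly_C_ser)
  moreover have "infinite (UNIV - {0 :: 'a})" by (simp add: infinite_UNIV_char_0)
  ultimately have "infinite {x. poly p x = 0}" using finite_subset by blast
  then have "p = 0" using poly_roots_finite by blast
  then have "poly p t = 0" by simp
  then show "C_ser lam q t (\<alpha> \<circ> transpose k (Suc k)) = C_ser lam q t \<alpha>"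
    by (simp add: p_def poly_C_ser)
qed

section \<open>Cancellation of attacking fillings\<close>

definition clashing_cells :: "nat list \<Rightarrow> (nat \<times> nat \<Rightarrow> letter) \<Rightarrow> (nat \<times> nat) set" where
  "clashing_cells lam \<sigma> = {u \<in> dg lam. \<exists>v\<in>dg lam. attacks u v \<and> fst (\<sigma> u) = fst (\<sigma> v)}"

definition signed_weight :: "nat list \<Rightarrow> 'a::comm_ring_1 \<Rightarrow> 'a \<Rightarrow> (nat \<times> nat \<Rightarrow> letter) \<Rightarrow> 'a" where
  "signed_weight lam q t \<sigma> = (-1) ^ nneg lam \<sigma> * q ^ maj lam \<sigma> * t ^ (npos lam \<sigma> + quinv lam \<sigma>)"

lemma finite_clashing_cells: "finite (clashing_cells lam \<sigma>)"
  by (simp add: clashing_cells_def finite_dg)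

lemma attacking_iff_attacks: "attacking u v \<or> attacking v u \<longleftrightarrow> attacks u v \<or> attacks v u"
  by (auto simp: attacking_def attacks_def)

lemma nonattacking_iff: "nonattacking lam \<sigma> \<longleftrightarrow> clashing_cells lam \<sigma> = {}"
proof -
  have "nonattacking lam \<sigma> \<longleftrightarrow>
      (\<forall>u\<in>dg lam. \<forall>v\<in>dg lam. attacking u v \<or> attacking v u \<longrightarrow> fst (\<sigma> u) \<noteq> fst (\<sigma> v))"
    unfolding nonattacking_def by metis
  also have "\<dots> \<longleftrightarrow> (\<forall>u\<in>dg lam. \<forall>v\<in>dg lam. attacks u v \<longrightarrow> fst (\<sigma> u) \<noteq> fst (\<sigma> v))"
    unfolding attacking_iff_attacks by metis
  finally show ?thesis by (auto simp: clashing_cells_def)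
qed

lemma clashing_cells_toggle [simp]: "clashing_cells lam (toggle p \<sigma>) = clashing_cells lam \<sigma>"
  by (simp add: clashing_cells_def)

lemma Iv_toggle: "Iv (toggle p \<sigma> u) (toggle p \<sigma> v) \<longleftrightarrow>
    (if u = p \<and> fst (\<sigma> u) = fst (\<sigma> v) then \<not> snd (\<sigma> p) else Iv (\<sigma> u) (\<sigma> v))"
  by (auto simp: Iv_iff toggle_def)

lemma last_clashing_cell_unique_target:
  assumes "clashing_cells lam \<sigma> \<noteq> {}" and p: "p = Min (clashing_cells lam \<sigma>)"
  obtains v where "v \<in> dg lam" "attacks p v" "fst (\<sigma> v) = fst (\<sigma> p)"
    "\<forall>x\<in>dg lam. (attacks p x \<or> p = cell_above x) \<and> fst (\<sigma> x) = fst (\<sigma> p) \<longrightarrow> x = v"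
proof -
  have "p \<in> clashing_cells lam \<sigma>" using Min_in[OF finite_clashing_cells assms(1)] p by simp
  then obtain v where v: "v \<in> dg lam" "attacks p v" "fst (\<sigma> v) = fst (\<sigma> p)"
    by (auto simp: clashing_cells_def)
  have last: "\<not> attacks x y" if "x \<in> dg lam" "y \<in> dg lam" "x < p" "fst (\<sigma> x) = fst (\<sigma> y)" for x y
  proof -
    have "x \<notin> clashing_cells lam \<sigma>" using Min_le[OF finite_clashing_cells, of x lam \<sigma>] that(3) p
      by auto
    then show ?thesis using that by (auto simp: clashing_cells_def)
  qed
  have "x = v" if x: "x \<in> dg lam" "attacks p x \<or> p = cell_above x" "fst (\<sigma> x) = fst (\<sigma> p)" for x
  proof (rule ccontr)
    assume "x \<noteq> v"
    have less: "x < p" "v < p" using attacks_less x(2) v(2) by blast+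
    consider "x < v" | "v < x" using \<open>x \<noteq> v\<close> by (meson linorder_neqE)
    then show False
    proof cases
      case 1
      then have "attacks v x" using attacks_between[OF x(2) _ less(2)] by blast
      then show False using last[OF v(1) x(1) less(2)] v(3) x(3) by simp
    next
      case 2
      then have "attacks x v" using attacks_between[of p v x] v(2) less(1) by blast
      then show False using last[OF x(1) v(1) less(1)] v(3) x(3) by simp
    qed
  qed
  then show ?thesis using that v by blast
qed

lemma toggle_last_clashing_cell:
  assumes \<sigma>: "\<sigma> \<in> letter_fillings (dg lam)" and ne: "clashing_cells lam \<sigma> \<noteq> {}"
    and p: "p = Min (clashing_cells lam \<sigma>)" and pos: "\<not> snd (\<sigma> p)"
  shows "maj lam (toggle p \<sigma>) = maj lam \<sigma>" "quinv lam (toggle p \<sigma>) = Suc (quinv lam \<sigma>)"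
proof -
  obtain v where v: "v \<in> dg lam" "attacks p v" "fst (\<sigma> v) = fst (\<sigma> p)"
    and unique: "\<forall>x\<in>dg lam. (attacks p x \<or> p = cell_above x) \<and> fst (\<sigma> x) = fst (\<sigma> p) \<longrightarrow> x = v"
    by (rule last_clashing_cell_unique_target[OF ne p])
  have pD: "p \<in> dg lam" using Min_in[OF finite_clashing_cells ne] p
    by (simp add: clashing_cells_def)
  have "p \<noteq> cell_above v" using v(2) by (auto simp: attacks_def cell_above_def)
  then have des: "is_descent lam (toggle p \<sigma>) u = is_descent lam \<sigma> u" for u
    unfolding is_descent_iff Iv_toggle using unique by metis
  then show "maj lam (toggle p \<sigma>) = maj lam \<sigma>" by (simp add: maj_def)
  have "attack_inversions lam (toggle p \<sigma>) = insert (p, v) (attack_inversions lam \<sigma>)"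
  proof (intro equalityI subsetI)
    fix x assume "x \<in> attack_inversions lam (toggle p \<sigma>)"
    then show "x \<in> insert (p, v) (attack_inversions lam \<sigma>)"
      using unique by (auto simp: attack_inversions_def Iv_toggle split: if_splits)
  next
    fix x assume "x \<in> insert (p, v) (attack_inversions lam \<sigma>)"
    then show "x \<in> attack_inversions lam (toggle p \<sigma>)"
      using pD v pos by (auto simp: attack_inversions_def Iv_toggle)
  qed
  moreover have "(p, v) \<notin> attack_inversions lam \<sigma>" using v pos
    by (auto simp: attack_inversions_def Iv_iff)
  ultimately have "card (attack_inversions lam (toggle p \<sigma>)) = Suc (card (attack_inversions lam \<sigma>))"
    by (simp add: finite_attack_inversions)
  then show "quinv lam (toggle p \<sigma>) = Suc (quinv lam \<sigma>)"
    using quinv_add_arms[OF \<sigma>] quinv_add_arms[OF toggle_letter_fillings[OF \<sigma> pD]] des by simp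
qed

lemma npos_toggle:
  assumes "p \<in> dg lam" "\<not> snd (\<sigma> p)"
  shows "npos lam \<sigma> = Suc (npos lam (toggle p \<sigma>))"
proof -
  have "{u\<in>dg lam. \<not> snd (\<sigma> u)} = insert p {u\<in>dg lam. \<not> snd (toggle p \<sigma> u)}"
    "p \<notin> {u\<in>dg lam. \<not> snd (toggle p \<sigma> u)}"
    using assms by (auto simp: toggle_def)
  then show ?thesis by (simp add: npos_def finite_dg)
qed

lemma signed_weight_toggle_last_clashing_cell:
  assumes \<sigma>: "\<sigma> \<in> letter_fillings (dg lam)" "clashing_cells lam \<sigma> \<noteq> {}"
    and p: "p = Min (clashing_cells lam \<sigma>)"
  shows "signed_weight lam q t (toggle p \<sigma>) = - signed_weight lam q t \<sigma>"
proof -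
  have pD: "p \<in> dg lam" using Min_in[OF finite_clashing_cells \<sigma>(2)] p
    by (simp add: clashing_cells_def)
  have positive: "signed_weight lam q t (toggle p \<tau>) = - signed_weight lam q t \<tau>"
    if "\<tau> \<in> letter_fillings (dg lam)" "clashing_cells lam \<tau> \<noteq> {}"
      "p = Min (clashing_cells lam \<tau>)" "\<not> snd (\<tau> p)"
    for \<tau>
    using card_negative_toggle[of "dg lam" p \<tau>, OF finite_dg pD that(4)]
    by (simp add: signed_weight_def nneg_def toggle_last_clashing_cell[OF that]
        npos_toggle[of p lam \<tau>, OF pD that(4)])
  show ?thesis
  proof (cases "snd (\<sigma> p)")
    case True
    then have "\<not> snd (toggle p \<sigma> p)" by (simp add: toggle_def)
    then have "signed_weight lam q t (toggle p (toggle p \<sigma>)) = - signed_weight lam q t (toggle p \<sigma>)"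
      using \<sigma> p pD by (intro positive) (simp_all add: toggle_letter_fillings)
    then show ?thesis by simp
  qed (use positive assms in blast)
qed

lemma sum_attacking_eq_0:
  fixes q t :: "'a::field_char_0"
  shows "(\<Sum>\<sigma> | \<sigma> \<in> letter_fillings (dg lam) \<and> content lam \<sigma> = \<alpha> \<and> \<not> nonattacking lam \<sigma>.
    signed_weight lam q t \<sigma>) = 0"
proof (rule sum_sign_reversing[where h = "\<lambda>\<sigma>. toggle (Min (clashing_cells lam \<sigma>)) \<sigma>"])
  fix \<sigma> assume "\<sigma> \<in> {\<sigma>. \<sigma> \<in> letter_fillings (dg lam) \<and> content lam \<sigma> = \<alpha> \<and> \<not> nonattacking lam \<sigma>}"
  then have \<sigma>: "\<sigma> \<in> letter_fillings (dg lam)" "content lam \<sigma> = \<alpha>" "clashing_cells lam \<sigma> \<noteq> {}"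
    by (auto simp: nonattacking_iff)
  have "Min (clashing_cells lam \<sigma>) \<in> dg lam"
    using Min_in[OF finite_clashing_cells \<sigma>(3)] by (simp add: clashing_cells_def)
  then show "toggle (Min (clashing_cells lam \<sigma>)) \<sigma> \<in>
      {\<sigma>. \<sigma> \<in> letter_fillings (dg lam) \<and> content lam \<sigma> = \<alpha> \<and> \<not> nonattacking lam \<sigma>}"
    using \<sigma> by (simp add: toggle_letter_fillings content_eq_count nonattacking_iff)
  show "signed_weight lam q t (toggle (Min (clashing_cells lam \<sigma>)) \<sigma>) = - signed_weight lam q t \<sigma>"
    by (rule signed_weight_toggle_last_clashing_cell[OF \<sigma>(1,3) refl])
qed simp

theorem S_ser_eq_pleth_sum:
  fixes q t :: "'a::field_char_0"
  shows "S_ser lam q t (count M) = pleth_sum (dg lam) (\<lambda>_. 1) (filling_weight lam q t) t M"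
proof -
  define A where "A = {\<sigma> \<in> letter_fillings (dg lam). content lam \<sigma> = count M}"
  have A: "A = {\<sigma> \<in> letter_fillings (dg lam). abs_content lam \<sigma> = M}"
    by (simp add: A_def content_eq_count count_inject)
  have "finite A" unfolding A
    by (rule finite_letter_fillings_abs_content[OF finite_dg zero_less_one])
  then have "sum (signed_weight lam q t) A =
      sum (signed_weight lam q t) {\<sigma> \<in> A. nonattacking lam \<sigma>} +
      sum (signed_weight lam q t) {\<sigma> \<in> A. \<not> nonattacking lam \<sigma>}"
    by (subst sum.union_disjoint[symmetric]) (auto intro!: sum.cong)
  also have "\<dots> = S_ser lam q t (count M)"
    using sum_attacking_eq_0[where lam = lam and \<alpha> = "count M" and q = q and t = t]
    by (simp add: A_def S_ser_def signed_weight_def superfillings_eq_letter_fillings conj_ac)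
  finally show ?thesis
    by (simp add: A pleth_sum_def signed_weight_def filling_weight_def filling_sign_def
        nneg_def npos_def power_add mult_ac)
qed

section \<open>Dominance\<close>

lemma homogeneous_series_if_content:
  assumes "\<And>\<alpha>. F \<alpha> \<noteq> 0 \<Longrightarrow> \<exists>\<sigma>\<in>superfillings lam. content lam \<sigma> = \<alpha>"
  shows "homogeneous_series (card (dg lam)) F"
  unfolding homogeneous_series_def
proof (intro allI impI)
  fix \<alpha> assume "F \<alpha> \<noteq> 0"
  then obtain \<sigma> where \<sigma>: "\<sigma> \<in> superfillings lam" "content lam \<sigma> = \<alpha>" using assms by blast
  define M where "M = abs_content lam \<sigma>"
  have "0 \<notin># M"
    using \<sigma>(1) set_mset_weighted_content[OF finite_dg, of lam "\<lambda>_. 1" "fst \<circ> \<sigma>"]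
    by (force simp: M_def superfillings_def)
  moreover have "\<alpha> = count M" "size M = card (dg lam)"
    using \<sigma>(2) by (simp_all add: M_def content_eq_count size_weighted_content)
  ultimately show "\<exists>M. \<alpha> = count M \<and> 0 \<notin># M \<and> size M = card (dg lam)" by blast
qed

lemma homogeneous_C_ser: "homogeneous_series (card (dg lam)) (C_ser lam q t)"
proof (rule homogeneous_series_if_content)
  fix \<alpha> assume "C_ser lam q t \<alpha> \<noteq> 0"
  then have "{\<sigma> \<in> posfillings lam. content lam \<sigma> = \<alpha>} \<noteq> {}" unfolding C_ser_def by (metis sum.empty)
  then show "\<exists>\<sigma>\<in>superfillings lam. content lam \<sigma> = \<alpha>" by (auto simp: posfillings_def)
qed

lemma S_ser_nonzeroE:
  assumes "S_ser lam q t \<alpha> \<noteq> 0"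
  obtains \<sigma> where "\<sigma> \<in> superfillings lam" "nonattacking lam \<sigma>" "content lam \<sigma> = \<alpha>"
proof -
  define F where "F = {\<sigma> \<in> superfillings lam. nonattacking lam \<sigma> \<and> content lam \<sigma> = \<alpha>}"
  have "F \<noteq> {}" using assms unfolding S_ser_def F_def[symmetric] by auto
  then obtain \<sigma> where "\<sigma> \<in> F" by blast
  then show ?thesis using that[of \<sigma>] by (simp add: F_def)
qed

lemma homogeneous_S_ser: "homogeneous_series (card (dg lam)) (S_ser lam q t)"
  by (rule homogeneous_series_if_content) (blast elim: S_ser_nonzeroE)

lemma card_dg_columns: "card {u \<in> dg lam. snd u \<le> i} = sum_list (take i lam)"
proof -
  define n where "n = min i (length lam)"
  have "card {u \<in> dg lam. snd u \<le> i} = card (SIGMA j:{..<n}. {1..lam ! j})"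
    by (rule bij_betw_same_card[of "\<lambda>(r, j). (j - 1, r)"],
        rule bij_betwI[where g = "\<lambda>(j, r). (r, Suc j)"])
      (auto simp: dg_def col_ht_def n_def)
  also have "\<dots> = (\<Sum>j<n. lam ! j)" by simp
  also have "\<dots> = sum_list (take i lam)"
    by (simp add: sum_list_sum_nth n_def atLeast0LessThan min.commute)
  finally show ?thesis .
qed

lemma card_dg: "card (dg lam) = sum_list lam"
proof -
  have "{u \<in> dg lam. snd u \<le> length lam} = dg lam" by (auto simp: dg_def)
  then show ?thesis using card_dg_columns[of lam "length lam"] by simp
qed

lemma dg_left:
  assumes "is_partition lam" "(r, j) \<in> dg lam" "1 \<le> i" "i \<le> j"
  shows "(r, i) \<in> dg lam"
proof -
  have "lam ! (j - 1) \<le> lam ! (i - 1)"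
  proof (cases "i = j")
    case False
    then show ?thesis using assms by (auto simp: is_partition_def dg_def sorted_wrt_iff_nth_less)
  qed simp
  then show ?thesis using assms by (auto simp: dg_def col_ht_def)
qed

lemma nonattacking_inj_on_row:
  assumes "nonattacking lam \<sigma>"
  shows "inj_on (\<lambda>u. fst (\<sigma> u)) {u \<in> dg lam. fst u = r}"
proof (rule inj_onI, rule ccontr)
  fix u v assume uv: "u \<in> {u \<in> dg lam. fst u = r}" "v \<in> {u \<in> dg lam. fst u = r}"
    "fst (\<sigma> u) = fst (\<sigma> v)" "u \<noteq> v"
  then have "attacking u v \<or> attacking v u" by (auto simp: attacking_def prod_eq_iff)
  then show False using assms uv unfolding nonattacking_def by fastforce
qed

lemma card_row_small_entries_le:
  assumes lam: "is_partition lam" and \<sigma>: "\<sigma> \<in> superfillings lam" "nonattacking lam \<sigma>"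
  shows "card {u \<in> dg lam. fst u = r \<and> fst (\<sigma> u) \<le> i} \<le> card {u \<in> dg lam. fst u = r \<and> snd u \<le> i}"
proof (cases "\<forall>j\<in>{1..i}. (r, j) \<in> dg lam")
  case True
  have "inj_on (\<lambda>u. fst (\<sigma> u)) {u \<in> dg lam. fst u = r \<and> fst (\<sigma> u) \<le> i}"
    by (rule inj_on_subset[OF nonattacking_inj_on_row[OF \<sigma>(2), of r]]) blast
  moreover have "(\<lambda>u. fst (\<sigma> u)) ` {u \<in> dg lam. fst u = r \<and> fst (\<sigma> u) \<le> i} \<subseteq> {1..i}"
    using \<sigma>(1) by (auto simp: superfillings_def)
  ultimately have "card {u \<in> dg lam. fst u = r \<and> fst (\<sigma> u) \<le> i} \<le> card {1..i}"
    by (rule card_inj_on_le) simp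
  also have "\<dots> = card (Pair r ` {1..i})" by (simp add: card_image inj_on_def)
  also have "\<dots> \<le> card {u \<in> dg lam. fst u = r \<and> snd u \<le> i}"
    using True by (intro card_mono) (auto simp: finite_dg)
  finally show ?thesis .
next
  case False
  then obtain j where j: "1 \<le> j" "j \<le> i" "(r, j) \<notin> dg lam" by auto
  have "snd u \<le> i" if "u \<in> dg lam" "fst u = r" for u
    using dg_left[OF lam, of r "snd u" j] that j by (cases u) force
  then show ?thesis by (intro card_mono) (auto simp: finite_dg)
qed

lemma card_small_entries_le:
  assumes "is_partition lam" "\<sigma> \<in> superfillings lam" "nonattacking lam \<sigma>"
  shows "card {u \<in> dg lam. fst (\<sigma> u) \<le> i} \<le> card {u \<in> dg lam. snd u \<le> i}"
proof -
  have rows: "card {u \<in> dg lam. P u} = (\<Sum>r\<in>fst ` dg lam. card {u \<in> dg lam. fst u = r \<and> P u})" for P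
  proof -
    have "card {u \<in> dg lam. P u} = (\<Sum>r\<in>fst ` dg lam. card {u \<in> {u \<in> dg lam. P u}. fst u = r})"
      unfolding card_eq_sum by (rule sum.group[symmetric]) (auto simp: finite_dg)
    then show ?thesis by (simp add: conj_ac)
  qed
  show ?thesis
    unfolding rows[of "\<lambda>u. fst (\<sigma> u) \<le> i"] rows[of "\<lambda>u. snd u \<le> i"]
    by (rule sum_mono) (rule card_row_small_entries_le[OF assms])
qed

lemma dominated_if_nonattacking:
  assumes lam: "is_partition lam"
    and \<sigma>: "\<sigma> \<in> superfillings lam" "nonattacking lam \<sigma>"
      "content lam \<sigma> = count (partition_monomial mu)"
  shows "dominated mu lam"
proof -
  have content: "partition_monomial mu = abs_content lam \<sigma>"
    using \<sigma>(3) by (simp add: content_eq_count count_inject)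
  have take: "sum_list (take i mu) = card {u \<in> dg lam. fst (\<sigma> u) \<le> i}" for i
    unfolding size_filter_partition_monomial[symmetric] content
    by (simp add: filter_mset_weighted_content finite_dg size_weighted_content)
  have "sum_list (take i mu) \<le> sum_list (take i lam)" for i
    using card_small_entries_le[OF lam \<sigma>(1,2)] by (simp add: take card_dg_columns)
  moreover have "sum_list mu = sum_list lam"
  proof -
    have "sum_list mu = size (partition_monomial mu)"
      by (simp add: partition_monomial_def size_part_content)
    then show ?thesis by (simp add: content size_weighted_content card_dg)
  qed
  ultimately show ?thesis by (simp add: dominated_def)
qed

lemma S_ser_eq_0_if_not_dominated:
  assumes "is_partition lam" "\<not> dominated mu lam"
  shows "S_ser lam q t (count (partition_monomial mu)) = 0"
  using assms dominated_if_nonattacking S_ser_nonzeroE by metis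

section \<open>The plethysm\<close>

lemma S_ser_power_sum_expansion:
  fixes q t :: "'a::field_char_0"
  assumes P: "finite P" "\<forall>mu\<in>P. is_partition mu"
    and C: "\<forall>\<alpha>. C_ser lam q t \<alpha> = (\<Sum>mu\<in>P. a mu * of_nat (pcoeff mu \<alpha>))"
  shows "S_ser lam q t \<alpha> = (\<Sum>mu\<in>P. a mu * (\<Prod>i<length mu. t ^ (mu ! i) - 1) * of_nat (pcoeff mu \<alpha>))"
proof (cases "\<exists>M. \<alpha> = count M \<and> 0 \<notin># M")
  case True
  then obtain M where M: "\<alpha> = count M" "0 \<notin># M" by blast
  interpret superization "dg lam" "\<lambda>_. 1" "filling_weight lam q t" Min
    by (rule superization_filling_weight)
  show ?thesis
    unfolding M(1) S_ser_eq_pleth_sum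
    using P C by (intro pleth_sum_power_sum_expansion M(2)) (simp_all only: super_sum_eq_C_ser)
next
  case False
  then have "S_ser lam q t \<alpha> = 0" using homogeneous_S_ser unfolding homogeneous_series_def by metis
  moreover have "pcoeff mu \<alpha> = 0" if "mu \<in> P" for mu
    using False P(2) that homogeneous_pcoeff unfolding homogeneous_series_def by metis
  ultimately show ?thesis by simp
qed

lemma C_ser_S_ser_power_sum_expansion:
  fixes q t :: "'a::field_char_0"
  obtains P a where "finite P" "\<forall>mu\<in>P. is_partition mu"
    "\<forall>\<alpha>. C_ser lam q t \<alpha> = (\<Sum>mu\<in>P. a mu * of_nat (pcoeff mu \<alpha>))"
    "\<forall>\<alpha>. S_ser lam q t \<alpha> = (\<Sum>mu\<in>P. a mu * (\<Prod>i<length mu. t ^ (mu ! i) - 1) * of_nat (pcoeff mu \<alpha>))"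
proof -
  obtain P a where "finite P" "\<forall>mu\<in>P. is_partition mu"
    and "\<forall>\<alpha>. C_ser lam q t \<alpha> = (\<Sum>mu\<in>P. a mu * of_nat (pcoeff mu \<alpha>))"
    by (rule power_sum_expansion[OF symmetric_C_ser homogeneous_C_ser, of lam q t])
  then show ?thesis by (intro that) (auto intro: S_ser_power_sum_expansion)
qed

lemma pleth_Xt1I:
  fixes t :: "'a::field"
  assumes P: "finite P" "\<forall>mu\<in>P. is_partition mu"
    and f: "\<forall>\<alpha>. f \<alpha> = (\<Sum>mu\<in>P. a mu * of_nat (pcoeff mu \<alpha>))"
    and g: "\<forall>\<alpha>. g \<alpha> = (\<Sum>mu\<in>P. a mu * (\<Prod>i<length mu. t ^ (mu ! i) - 1) * of_nat (pcoeff mu \<alpha>))"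
  shows "pleth_Xt1 t f g"
proof -
  define b where "b = (\<lambda>mu. if mu \<in> P then a mu else 0)"
  have supp: "{mu. b mu \<noteq> 0} \<subseteq> P" by (auto simp: b_def)
  have sum_b: "(\<Sum>mu\<in>P. a mu * h mu) = (\<Sum>mu | b mu \<noteq> 0. b mu * h mu)" for h :: "nat list \<Rightarrow> 'a"
  proof -
    have "(\<Sum>mu\<in>P. a mu * h mu) = (\<Sum>mu\<in>P. b mu * h mu)" by (simp add: b_def)
    also have "\<dots> = (\<Sum>mu | b mu \<noteq> 0. b mu * h mu)"
      using P(1) supp by (intro sum.mono_neutral_right) auto
    finally show ?thesis .
  qed
  show ?thesis
    unfolding pleth_Xt1_def
  proof (intro exI[of _ b] conjI allI impI)
    show "finite {mu. b mu \<noteq> 0}" using supp P(1) by (rule finite_subset)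
    show "is_partition mu" if "b mu \<noteq> 0" for mu using supp P(2) that by blast
    show "f \<alpha> = (\<Sum>mu | b mu \<noteq> 0. b mu * of_nat (pcoeff mu \<alpha>))" for \<alpha>
      using f sum_b by metis
    show "g \<alpha> = (\<Sum>mu | b mu \<noteq> 0. b mu * (\<Prod>i<length mu. t ^ (mu ! i) - 1) *
        of_nat (pcoeff mu \<alpha>))" for \<alpha>
      using g sum_b unfolding mult.assoc by metis
  qed
qed

theorem pleth_C_ser_iff:
  fixes q t :: "'a::field_char_0"
  shows "pleth_Xt1 t (C_ser lam q t) g \<longleftrightarrow> g = S_ser lam q t"
proof
  assume "pleth_Xt1 t (C_ser lam q t) g"
  then obtain a where a: "finite {mu. a mu \<noteq> 0}" "\<forall>mu\<in>{mu. a mu \<noteq> 0}. is_partition mu"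
      "\<forall>\<alpha>. C_ser lam q t \<alpha> = (\<Sum>mu | a mu \<noteq> 0. a mu * of_nat (pcoeff mu \<alpha>))"
    and g: "\<forall>\<alpha>. g \<alpha> =
      (\<Sum>mu | a mu \<noteq> 0. a mu * (\<Prod>i<length mu. t ^ (mu ! i) - 1) * of_nat (pcoeff mu \<alpha>))"
    unfolding pleth_Xt1_def by blast
  show "g = S_ser lam q t"
    using g by (simp add: fun_eq_iff S_ser_power_sum_expansion[OF a])
next
  obtain P a where "finite P" "\<forall>mu\<in>P. is_partition mu"
    "\<forall>\<alpha>. C_ser lam q t \<alpha> = (\<Sum>mu\<in>P. a mu * of_nat (pcoeff mu \<alpha>))"
    "\<forall>\<alpha>. S_ser lam q t \<alpha> =
      (\<Sum>mu\<in>P. a mu * (\<Prod>i<length mu. t ^ (mu ! i) - 1) * of_nat (pcoeff mu \<alpha>))"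
    by (rule C_ser_S_ser_power_sum_expansion[of lam q t])
  then have "pleth_Xt1 t (C_ser lam q t) (S_ser lam q t)" by (rule pleth_Xt1I)
  then show "pleth_Xt1 t (C_ser lam q t) g" if "g = S_ser lam q t" using that by simp
qed

lemma symmetric_S_ser: "symmetric_series (S_ser lam q (t :: 'a::field_char_0))"
proof -
  obtain P a where "\<forall>\<alpha>. S_ser lam q t \<alpha> =
      (\<Sum>mu\<in>P. a mu * (\<Prod>i<length mu. t ^ (mu ! i) - 1) * of_nat (pcoeff mu \<alpha>))"
    by (rule C_ser_S_ser_power_sum_expansion[of lam q t])
  then show ?thesis using symmetric_pcoeff by (simp add: symmetric_series_def)
qed

theorem mainTheorem5:
  fixes lam :: "nat list" and q t :: "'a::field_char_0"
  assumes "is_partition lam"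
  shows "pleth_Xt1 t (C_ser lam q t) (S_ser lam q t) \<and>
         (\<forall>g. pleth_Xt1 t (C_ser lam q t) g \<longrightarrow>
            (\<exists>c :: nat list \<Rightarrow> 'a. \<forall>\<alpha>. g \<alpha> =
               (\<Sum>mu \<in> {mu. is_partition mu \<and> dominated mu lam}. c mu * of_nat (mcoeff mu \<alpha>))))"
proof -
  define P where "P = {mu. is_partition mu \<and> dominated mu lam}"
  define c where "c = (\<lambda>mu. S_ser lam q t (count (partition_monomial mu)))"
  have "finite P"
    unfolding P_def
    by (rule finite_subset[OF _ finite_partitions[of "sum_list lam"]]) (auto simp: dominated_def)
  then have "S_ser lam q t \<alpha> = (\<Sum>mu\<in>P. c mu * of_nat (mcoeff mu \<alpha>))" for \<alpha>
    unfolding c_def using S_ser_eq_0_if_not_dominated[OF assms]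
    by (intro symmetric_series_monomial_expansion[OF symmetric_S_ser homogeneous_S_ser])
      (auto simp: P_def)
  then show ?thesis unfolding pleth_C_ser_iff P_def by blast
qed

end
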